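(* Let $N\ge1$, $w\ge0$, $k=w+2$ with $(k,N)\ne(2,1)$, and $\Gamma=\Gamma_1(N)$. Let $P\in\bar W_w^{\Gamma,+}$, put $Q=P|_U$ and $Q^{\pm}=\tfrac12 Q|_{1\pm\epsilon}\in\bar V_w^{\Gamma,\pm}$. Then $Q^-\in\bar V_w^{\Gamma,-,\mathrm{sym}}:=\{u\in\bar V_w^{\Gamma,-}:u|_{\epsilon S}=u\}$ and \[ 3\lambda(Q^+)=-\lambda(Q^-)-\lambda^{\mathcal{S}}(Q)\in\mathcal{P}_{k,N}^{\mathrm{ev}}. \] Conversely, for $R\in\bar V_w^{\Gamma,+}$, $\lambda(R)\in\mathcal{P}_{k,N}^{\mathrm{ev}}$ if and only if $R=\tfrac12 P|_{U(1+\epsilon)}$ for some $P\in\bar W_w^{\Gamma,+}$.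
   Context: $V_w$ is the $\mathbb{Q}$-space of homogeneous degree-$w$ polynomials in $X,Y$, with right $\mathrm{GL}(2,\mathbb{Z})$-action $P|_\gamma(X,Y)=P(aX+bY,cX+dY)$ for $\gamma=\begin{pmatrix}a&b\\c&d\end{pmatrix}$. $\epsilon=\begin{pmatrix}-1&0\\0&1\end{pmatrix}$, $J=-I$, $S=\begin{pmatrix}0&-1\\1&0\end{pmatrix}$, $U=\begin{pmatrix}1&-1\\1&0\end{pmatrix}$. $\bar V_w^\Gamma$ is the space of maps $P:\Gamma\backslash\mathrm{SL}(2,\mathbb{Z})\to V_w$ with $P|_J=P$, with right action $P|_\gamma(C)=P(C\gamma^{-1})|_\gamma$ for $\gamma\in\mathrm{SL}(2,\mathbb{Z})$ and $P|_\epsilon(C)=P(J\epsilon C\epsilon)|_\epsilon$, extended linearly to the group ring; $\bar V_w^{\Gamma,\pm}=\{P:P|_\epsilon=\pm P\}$ and $\bar W_w^{\Gamma,+}=\{P\in\bar V_w^{\Gamma}:P|_{1+S}=P|_{1+U+U^2}=0,\ P|_\epsilon=P\}$. $A(N)=\{(a,b)\in(\mathbb{Z}/N\mathbb{Z})^2:\gcd(a,b,N)=1\}$; $\Gamma_1(N)$ is the group of matrices in $\mathrm{SL}(2,\mathbb{Z})$ congruent to $\begin{pmatrix}1&*\\0&1\end{pmatrix}$ mod $N$; $C_{a,b}$ is the coset in $\Gamma_1(N)\backslash\mathrm{SL}(2,\mathbb{Z})$ of matrices with bottom row $\equiv(a,b)\bmod N$ (a bijection with $A(N)$). $\mathcal{D}_{k,N}$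 is the $\mathbb{Q}$-vector space with generators $Z_{a,b}^{r,s},P_{a,b}^{r,s},Z_c^k$ ($r,s\ge1$, $r+s=k$, $(a,b)\in A(N)$, $c\in\mathbb{Z}/N\mathbb{Z}$) and relations $P_{a,b}^{r,s}=\sum_{j=0}^{r-1}\binom{s-1+j}{j}Z_{a-b,b}^{r-j,s+j}+\sum_{j=0}^{s-1}\binom{r-1+j}{j}Z_{b-a,a}^{s-j,r+j}=Z_{a,b}^{r,s}+Z_{b,a}^{s,r}+Z_{a+b}^{r+s}$. $\mathcal{P}_{k,N}^{\mathrm{ev}}$ is the subspace spanned by all $P_{a,b}^{r,s}+(-1)^rP_{-a,b}^{r,s}+(-1)^sP_{a,-b}^{r,s}+(-1)^{r+s}P_{-a,-b}^{r,s}$ and all $Z_a^k+(-1)^kZ_{-a}^k$. For maps $P:\Gamma\backslash\mathrm{SL}(2,\mathbb{Z})\to V_w$: $\lambda(P)=\sum_{C}\lambda_C(P(CS))$ and $\lambda^{\mathcal{S}}(P)=\sum_C\lambda^{\mathcal{S}}_C(P(CS))$, sums over $C\in\Gamma\backslash\mathrm{SL}(2,\mathbb{Z})$, where $\lambda_{C_{a,b}},\lambda^{\mathcal{S}}_{C_{a,b}}:V_w\to\mathcal{D}_{k,N}$ are the linear maps $X^rY^s\mapsto r!\,s!\,Z_{a,b}^{r+1,s+1}$ and $X^rY^s\mapsto r!\,s!\,Z_{a+b}^{r+s+2}$, respectively. *)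

theory Defs
  imports
    "HOL-Analysis.Analysis"
    "HOL-Algebra.Coset"
    "HOL-Number_Theory.Cong"
    "HOL-Computational_Algebra.Polynomial"
    "HOL-Library.Poly_Mapping"
    "HOL-Library.FuncSet"
begin

section \<open>The groups\<close>

definition mat2 :: "int \<Rightarrow> int \<Rightarrow> int \<Rightarrow> int \<Rightarrow> int^2^2" where
  "mat2 a b c d = vector [vector [a, b], vector [c, d]]"

definition SL2Z :: "(int^2^2) monoid" where
  "SL2Z = \<lparr>carrier = {g. det g = 1}, mult = (**), one = mat 1\<rparr>"

definition mat_S :: "int^2^2" where "mat_S = mat2 0 (-1) 1 0"
definition mat_U :: "int^2^2" where "mat_U = mat2 1 (-1) 1 0"
definition mat_J :: "int^2^2" where "mat_J = mat2 (-1) 0 0 (-1)"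
definition mat_eps :: "int^2^2" where "mat_eps = mat2 (-1) 0 0 1"

definition Gamma1 :: "nat \<Rightarrow> (int^2^2) set" where
  "Gamma1 N = {g \<in> carrier SL2Z. [g $ 1 $ 1 = 1] (mod int N) \<and>
                 [g $ 2 $ 1 = 0] (mod int N) \<and> [g $ 2 $ 2 = 1] (mod int N)}"

text \<open>Residue classes modulo \<open>N\<close> are represented by the integers \<open>0, \<dots>, N - 1\<close>.\<close>

definition A_set :: "nat \<Rightarrow> (int \<times> int) set" where
  "A_set N = {(a, b). a \<in> {0..<int N} \<and> b \<in> {0..<int N} \<and> gcd a (gcd b (int N)) = 1}"

definition C_coset :: "nat \<Rightarrow> int \<Rightarrow> int \<Rightarrow> (int^2^2) set" where
  "C_coset N a b = {g \<in> carrier SL2Z. [g $ 2 $ 1 = a] (mod int N) \<and> [g $ 2 $ 2 = b] (mod int N)}"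

text \<open>The pair \<open>(a, b)\<close> with \<open>C = C_coset N a b\<close>.\<close>

definition coset_index :: "nat \<Rightarrow> (int^2^2) set \<Rightarrow> int \<times> int" where
  "coset_index N = inv_into (A_set N) (\<lambda>(a, b). C_coset N a b)"


section \<open>Homogeneous polynomials in two variables\<close>

text \<open>
  Elements of \<open>\<rat>[X, Y]\<close> are of type \<^typ>\<open>rat poly poly\<close>, the outer variable being \<open>Y\<close>:
  the coefficient of \<open>X\<^sup>r Y\<^sup>s\<close> in \<open>p\<close> is \<open>coeff (coeff p s) r\<close>.
\<close>

definition var_X :: "rat poly poly" where "var_X = [:[:0, 1:]:]"
definition var_Y :: "rat poly poly" where "var_Y = [:0, 1:]"

definition V :: "nat \<Rightarrow> rat poly poly set" where
  "V w = {p. \<forall>r s. coeff (coeff p s) r \<noteq> 0 \<longrightarrow> r + s = w}"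

definition subst_XY :: "rat poly poly \<Rightarrow> rat poly poly \<Rightarrow> rat poly poly \<Rightarrow> rat poly poly" where
  "subst_XY p A B = poly (map_poly (\<lambda>q. poly (map_poly (\<lambda>c. [:[:c:]:]) q) A) p) B"

definition poly_slash :: "rat poly poly \<Rightarrow> int^2^2 \<Rightarrow> rat poly poly" where
  "poly_slash p g = subst_XY p
     (of_int (g $ 1 $ 1) * var_X + of_int (g $ 1 $ 2) * var_Y)
     (of_int (g $ 2 $ 1) * var_X + of_int (g $ 2 $ 2) * var_Y)"


section \<open>Maps on cosets\<close>

text \<open>
  Maps \<open>\<Gamma>\SL(2, \<int>) \<rightarrow> V w\<close> are elements of the extensional function space
  \<open>rcosets\<^bsub>SL2Z\<^esub> \<Gamma> \<rightarrow>\<^sub>E V w\<close>, hence the restrictions below. (In HOL-Algebra the right cosets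
  are the sets \<open>\<Gamma> g\<close>.) The action of a group ring element is written out with
  \<open>madd\<close> and \<open>mscale\<close>.
\<close>

type_synonym coset_map = "(int^2^2) set \<Rightarrow> rat poly poly"

definition madd :: "(int^2^2) set \<Rightarrow> coset_map \<Rightarrow> coset_map \<Rightarrow> coset_map" where
  "madd \<Gamma> P Q = (\<lambda>C \<in> rcosets\<^bsub>SL2Z\<^esub> \<Gamma>. P C + Q C)"

definition mscale :: "(int^2^2) set \<Rightarrow> rat \<Rightarrow> coset_map \<Rightarrow> coset_map" where
  "mscale \<Gamma> c P = (\<lambda>C \<in> rcosets\<^bsub>SL2Z\<^esub> \<Gamma>. smult [:c:] (P C))"

definition mzero :: "(int^2^2) set \<Rightarrow> coset_map" where
  "mzero \<Gamma> = (\<lambda>C \<in> rcosets\<^bsub>SL2Z\<^esub> \<Gamma>. 0)"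

definition slash :: "(int^2^2) set \<Rightarrow> coset_map \<Rightarrow> int^2^2 \<Rightarrow> coset_map" where
  "slash \<Gamma> P g = (\<lambda>C \<in> rcosets\<^bsub>SL2Z\<^esub> \<Gamma>. poly_slash (P (C #>\<^bsub>SL2Z\<^esub> (inv\<^bsub>SL2Z\<^esub> g))) g)"

definition slash_eps :: "(int^2^2) set \<Rightarrow> coset_map \<Rightarrow> coset_map" where
  "slash_eps \<Gamma> P = (\<lambda>C \<in> rcosets\<^bsub>SL2Z\<^esub> \<Gamma>.
     poly_slash (P ((\<lambda>g. mat_J ** mat_eps ** g ** mat_eps) ` C)) mat_eps)"

definition Vbar :: "(int^2^2) set \<Rightarrow> nat \<Rightarrow> coset_map set" where
  "Vbar \<Gamma> w = {P \<in> rcosets\<^bsub>SL2Z\<^esub> \<Gamma> \<rightarrow>\<^sub>E V w. slash \<Gamma> P mat_J = P}"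

definition Vbar_plus :: "(int^2^2) set \<Rightarrow> nat \<Rightarrow> coset_map set" where
  "Vbar_plus \<Gamma> w = {P \<in> Vbar \<Gamma> w. slash_eps \<Gamma> P = P}"

definition Vbar_minus :: "(int^2^2) set \<Rightarrow> nat \<Rightarrow> coset_map set" where
  "Vbar_minus \<Gamma> w = {P \<in> Vbar \<Gamma> w. slash_eps \<Gamma> P = mscale \<Gamma> (-1) P}"

definition Vbar_minus_sym :: "(int^2^2) set \<Rightarrow> nat \<Rightarrow> coset_map set" where
  "Vbar_minus_sym \<Gamma> w = {u \<in> Vbar_minus \<Gamma> w. slash \<Gamma> (slash_eps \<Gamma> u) mat_S = u}"

definition Wbar_plus :: "(int^2^2) set \<Rightarrow> nat \<Rightarrow> coset_map set" where
  "Wbar_plus \<Gamma> w = {P \<in> Vbar \<Gamma> w.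
     madd \<Gamma> P (slash \<Gamma> P mat_S) = mzero \<Gamma> \<and>
     madd \<Gamma> (madd \<Gamma> P (slash \<Gamma> P mat_U)) (slash \<Gamma> P (mat_U ** mat_U)) = mzero \<Gamma> \<and>
     slash_eps \<Gamma> P = P}"


section \<open>The double zeta space\<close>

text \<open>\<open>GZ a b r s\<close>, \<open>GP a b r s\<close>, \<open>GS c k\<close> are the formal symbols
  \<open>Z\<^sub>a\<^sub>,\<^sub>b\<^sup>r\<^sup>,\<^sup>s\<close>, \<open>P\<^sub>a\<^sub>,\<^sub>b\<^sup>r\<^sup>,\<^sup>s\<close>, \<open>Z\<^sub>c\<^sup>k\<close>.\<close>

datatype D_gen = GZ int int nat nat | GP int int nat nat | GS int nat

definition D_gens :: "nat \<Rightarrow> nat \<Rightarrow> D_gen set" where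
  "D_gens k N =
     {GZ a b r s |a b r s. (a, b) \<in> A_set N \<and> r \<ge> 1 \<and> s \<ge> 1 \<and> r + s = k} \<union>
     {GP a b r s |a b r s. (a, b) \<in> A_set N \<and> r \<ge> 1 \<and> s \<ge> 1 \<and> r + s = k} \<union>
     {GS c k |c. c \<in> {0..<int N}}"

definition fscale :: "rat \<Rightarrow> ('g \<Rightarrow>\<^sub>0 rat) \<Rightarrow> ('g \<Rightarrow>\<^sub>0 rat)" where
  "fscale c x = Poly_Mapping.map (\<lambda>v. c * v) x"

lemma lookup_fscale: "poly_mapping.lookup (fscale c x) g = c * poly_mapping.lookup x g"
  by (simp add: fscale_def Poly_Mapping.map.rep_eq when_def)

global_interpretation formal: vector_space fscale
proof
  fix c d :: rat and x y :: "'g \<Rightarrow>\<^sub>0 rat"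
  show "fscale c (x + y) = fscale c x + fscale c y"
    by (rule poly_mapping_eqI) (simp add: lookup_fscale lookup_add distrib_left)
  show "fscale (c + d) x = fscale c x + fscale d x"
    by (rule poly_mapping_eqI) (simp add: lookup_fscale lookup_add distrib_right)
  show "fscale c (fscale d x) = fscale (c * d) x"
    by (rule poly_mapping_eqI) (simp add: lookup_fscale mult.assoc)
  show "fscale 1 x = x"
    by (rule poly_mapping_eqI) (simp add: lookup_fscale)
qed

definition formal_space :: "nat \<Rightarrow> nat \<Rightarrow> (D_gen \<Rightarrow>\<^sub>0 rat) set" where
  "formal_space k N = {x. Poly_Mapping.keys x \<subseteq> D_gens k N}"

text \<open>The generators as formal vectors; lower indices are integers, reduced modulo \<open>N\<close>.\<close>

definition genZ :: "nat \<Rightarrow> int \<Rightarrow> int \<Rightarrow> nat \<Rightarrow> nat \<Rightarrow> (D_gen \<Rightarrow>\<^sub>0 rat)" where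
  "genZ N a b r s = Poly_Mapping.single (GZ (a mod int N) (b mod int N) r s) 1"

definition genP :: "nat \<Rightarrow> int \<Rightarrow> int \<Rightarrow> nat \<Rightarrow> nat \<Rightarrow> (D_gen \<Rightarrow>\<^sub>0 rat)" where
  "genP N a b r s = Poly_Mapping.single (GP (a mod int N) (b mod int N) r s) 1"

definition genS :: "nat \<Rightarrow> int \<Rightarrow> nat \<Rightarrow> (D_gen \<Rightarrow>\<^sub>0 rat)" where
  "genS N c k = Poly_Mapping.single (GS (c mod int N) k) 1"

definition D_relators :: "nat \<Rightarrow> nat \<Rightarrow> (D_gen \<Rightarrow>\<^sub>0 rat) set" where
  "D_relators k N =
     {genP N a b r s
        - ((\<Sum>j = 0..r-1. fscale (of_nat ((s - 1 + j) choose j)) (genZ N (a - b) b (r - j) (s + j)))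
         + (\<Sum>j = 0..s-1. fscale (of_nat ((r - 1 + j) choose j)) (genZ N (b - a) a (s - j) (r + j))))
      |a b r s. (a, b) \<in> A_set N \<and> r \<ge> 1 \<and> s \<ge> 1 \<and> r + s = k} \<union>
     {genP N a b r s - (genZ N a b r s + genZ N b a s r + genS N (a + b) (r + s))
      |a b r s. (a, b) \<in> A_set N \<and> r \<ge> 1 \<and> s \<ge> 1 \<and> r + s = k}"

text \<open>
  The quotient of \<open>formal_space k N\<close> by the span of the relators: its elements are the
  classes \<open>D_class k N x\<close>, with the vector space operations defined on representatives.
\<close>

definition D_class :: "nat \<Rightarrow> nat \<Rightarrow> (D_gen \<Rightarrow>\<^sub>0 rat) \<Rightarrow> (D_gen \<Rightarrow>\<^sub>0 rat) set" where
  "D_class k N x = {y \<in> formal_space k N. y - x \<in> formal.span (D_relators k N)}"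

definition D_space :: "nat \<Rightarrow> nat \<Rightarrow> (D_gen \<Rightarrow>\<^sub>0 rat) set set" where
  "D_space k N = D_class k N ` formal_space k N"

definition D_add :: "nat \<Rightarrow> nat \<Rightarrow> (D_gen \<Rightarrow>\<^sub>0 rat) set \<Rightarrow> (D_gen \<Rightarrow>\<^sub>0 rat) set \<Rightarrow> (D_gen \<Rightarrow>\<^sub>0 rat) set" where
  "D_add k N A B = (\<Union>x\<in>A. \<Union>y\<in>B. D_class k N (x + y))"

definition D_scale :: "nat \<Rightarrow> nat \<Rightarrow> rat \<Rightarrow> (D_gen \<Rightarrow>\<^sub>0 rat) set \<Rightarrow> (D_gen \<Rightarrow>\<^sub>0 rat) set" where
  "D_scale k N c A = (\<Union>x\<in>A. D_class k N (fscale c x))"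

lemma D_class_eqI:
  assumes "x - y \<in> formal.span (D_relators k N)"
  shows "D_class k N x = D_class k N y"
proof -
  have "z - x \<in> formal.span (D_relators k N) \<longleftrightarrow> z - y \<in> formal.span (D_relators k N)" for z
  proof -
    have "(z - x) + (x - y) = z - y" by simp
    then show ?thesis
      using formal.span_add_eq2[OF assms, of "z - x"] by metis
  qed
  then show ?thesis by (simp add: D_class_def)
qed

lemma D_class_self: "x \<in> formal_space k N \<Longrightarrow> x \<in> D_class k N x"
  by (simp add: D_class_def formal.span_zero)

lemma D_scale_class:
  assumes "x \<in> formal_space k N"
  shows "D_scale k N c (D_class k N x) = D_class k N (fscale c x)"
proof -
  have "D_class k N (fscale c x') = D_class k N (fscale c x)" if "x' \<in> D_class k N x" for x'
  proof (rule D_class_eqI)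
    have "fscale c (x' - x) \<in> formal.span (D_relators k N)"
      by (rule formal.span_scale) (use that in \<open>simp add: D_class_def\<close>)
    then show "fscale c x' - fscale c x \<in> formal.span (D_relators k N)"
      by (simp add: formal.scale_right_diff_distrib)
  qed
  moreover have "D_class k N x \<noteq> {}"
    using D_class_self[OF assms] by (metis empty_iff)
  ultimately show ?thesis
    unfolding D_scale_def by (metis SUP_eq_const)
qed

lemma D_add_class:
  assumes "x \<in> formal_space k N" "y \<in> formal_space k N"
  shows "D_add k N (D_class k N x) (D_class k N y) = D_class k N (x + y)"
proof -
  have "D_class k N (x' + y') = D_class k N (x + y)"
    if "x' \<in> D_class k N x" "y' \<in> D_class k N y" for x' y'
  proof (rule D_class_eqI)
    have "(x' - x) + (y' - y) \<in> formal.span (D_relators k N)"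
      by (rule formal.span_add) (use that in \<open>simp_all add: D_class_def\<close>)
    then show "x' + y' - (x + y) \<in> formal.span (D_relators k N)"
      by (simp add: algebra_simps)
  qed
  moreover have "D_class k N x \<noteq> {}" "D_class k N y \<noteq> {}"
    using D_class_self[OF assms(1)] D_class_self[OF assms(2)] by (metis empty_iff)+
  ultimately show ?thesis
    unfolding D_add_def by (simp cong: SUP_cong)
qed

definition P_ev_gens :: "nat \<Rightarrow> nat \<Rightarrow> (D_gen \<Rightarrow>\<^sub>0 rat) set" where
  "P_ev_gens k N =
     {genP N a b r s + fscale ((-1) ^ r) (genP N (-a) b r s) + fscale ((-1) ^ s) (genP N a (-b) r s)
        + fscale ((-1) ^ (r + s)) (genP N (-a) (-b) r s)
      |a b r s. (a, b) \<in> A_set N \<and> r \<ge> 1 \<and> s \<ge> 1 \<and> r + s = k} \<union>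
     {genS N a k + fscale ((-1) ^ k) (genS N (-a) k) |a. a \<in> {0..<int N}}"

definition P_ev :: "nat \<Rightarrow> nat \<Rightarrow> (D_gen \<Rightarrow>\<^sub>0 rat) set set" where
  "P_ev k N = D_class k N ` formal.span (P_ev_gens k N)"


section \<open>The maps to the double zeta space\<close>

text \<open>Sums in the quotient are formed on representatives; the class is taken at the end.\<close>

definition lam_coset :: "nat \<Rightarrow> nat \<Rightarrow> (int^2^2) set \<Rightarrow> rat poly poly \<Rightarrow> (D_gen \<Rightarrow>\<^sub>0 rat)" where
  "lam_coset N w C p = (case coset_index N C of (a, b) \<Rightarrow>
     \<Sum>(r, s) \<in> {(r, s). r + s = w}.
       fscale (coeff (coeff p s) r * (fact r * fact s)) (genZ N a b (r + 1) (s + 1)))"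

definition lamS_coset :: "nat \<Rightarrow> nat \<Rightarrow> (int^2^2) set \<Rightarrow> rat poly poly \<Rightarrow> (D_gen \<Rightarrow>\<^sub>0 rat)" where
  "lamS_coset N w C p = (case coset_index N C of (a, b) \<Rightarrow>
     \<Sum>(r, s) \<in> {(r, s). r + s = w}.
       fscale (coeff (coeff p s) r * (fact r * fact s)) (genS N (a + b) (r + s + 2)))"

definition lam :: "nat \<Rightarrow> nat \<Rightarrow> coset_map \<Rightarrow> (D_gen \<Rightarrow>\<^sub>0 rat) set" where
  "lam N w P = D_class (w + 2) N
     (\<Sum>C \<in> rcosets\<^bsub>SL2Z\<^esub> (Gamma1 N). lam_coset N w C (P (C #>\<^bsub>SL2Z\<^esub> mat_S)))"

definition lamS :: "nat \<Rightarrow> nat \<Rightarrow> coset_map \<Rightarrow> (D_gen \<Rightarrow>\<^sub>0 rat) set" where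
  "lamS N w P = D_class (w + 2) N
     (\<Sum>C \<in> rcosets\<^bsub>SL2Z\<^esub> (Gamma1 N). lamS_coset N w C (P (C #>\<^bsub>SL2Z\<^esub> mat_S)))"

end

theory Submission
  imports Defs "HOL-Library.Function_Algebras"
begin

text \<open>
  Identify a coset map \<open>P\<close> with the function \<open>F(a, b) = P(C\<^sub>b\<^sub>,\<^sub>-\<^sub>a)\<close>. The action then becomes
  simultaneous substitution of a matrix into \<open>(a, b)\<close> and \<open>(X, Y)\<close>, and it extends to
  \<open>GL(2, \<int>)\<close>. Put \<open>T = (X + Y, Y)\<close> and \<open>\<delta> = \<epsilon>S = (Y, X)\<close>. The relations of the double zeta space say
  that the class \<open>\<Pi>(F)\<close> of \<open>P\<^sub>a\<^sub>,\<^sub>b\<^sup>r\<^sup>,\<^sup>s\<close> paired with \<open>F\<close> is \<open>\<Lambda>(F|(1 + \<delta>)T) = \<Lambda>(F|(1 + \<delta>)) + \<Lambda>\<^sup>S(F)\<close>,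
  hence \<open>2\<Lambda>(G|(T - 1)) = \<Lambda>\<^sup>S(G)\<close> whenever \<open>G|\<delta> = G\<close>.

  For a period map \<open>P\<close> one has \<open>P|\<delta> = -P\<close>, \<open>P|T\<^sup>-\<^sup>1 = P + Q\<close> and \<open>P|T = P + Q|\<epsilon>\<close>. The function
  \<open>G = -P - 2Q\<close> is \<open>\<delta>\<close>-invariant with \<open>G|(T - 1) = 2Q + Q|\<epsilon> = 3Q\<^sup>+ + Q\<^sup>-\<close> and
  \<open>\<Lambda>\<^sup>S(G) = -2\<Lambda>\<^sup>S(Q)\<close>, which is the identity; \<open>\<Lambda>(Q\<^sup>-) + \<Lambda>\<^sup>S(Q\<^sup>-)/2 = \<Pi>(Q\<^sup>-)/2\<close> lies in
  \<open>\<P>\<^sup>e\<^sup>v\<close>.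

  Conversely, \<open>\<Lambda>(R) \<in> \<P>\<^sup>e\<^sup>v\<close> forces \<open>R = h + g|(T - 1)\<close> with \<open>g\<close> and \<open>h\<close> \<open>\<delta>\<close>-invariant and
  \<open>h|\<epsilon> = -h\<close>. Then \<open>P = g|(U - U\<^sup>2)\<close> satisfies the three-term relation and \<open>P|\<delta> = -P\<close> automatically;
  comparing \<open>\<epsilon>\<close>-odd parts of \<open>R\<close> gives \<open>P|\<epsilon> = P\<close>, and comparing even parts gives
  \<open>R = P|U(1 + \<epsilon>)/2\<close>.
\<close>

section \<open>Substitution in homogeneous polynomials\<close>

text \<open>Polynomial identities are verified pointwise over the rationals. The outer variable Y is
  specialised first, to a constant of the coefficient ring.\<close>

definition ev :: "rat poly poly \<Rightarrow> rat \<Rightarrow> rat \<Rightarrow> rat" where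
  "ev p x y = poly (poly p [:y:]) x"

definition XY :: "nat \<Rightarrow> nat \<Rightarrow> rat poly poly" where
  "XY r s = monom (monom 1 r) s"

lemma ev_simps [simp]:
  "ev 0 x y = 0" "ev 1 x y = 1" "ev (p + q) x y = ev p x y + ev q x y"
  "ev (p - q) x y = ev p x y - ev q x y" "ev (- p) x y = - ev p x y"
  "ev (p * q) x y = ev p x y * ev q x y" "ev (smult [:c:] p) x y = c * ev p x y"
  "ev var_X x y = x" "ev var_Y x y = y"
  by (simp_all add: ev_def var_X_def var_Y_def)

lemma ev_of_int [simp]: "ev (of_int n) x y = of_int n"
  by (simp add: ev_def of_int_poly)

lemma ev_numeral [simp]: "ev (numeral n) x y = numeral n"
  using ev_of_int[of "numeral n" x y] by simp

lemma ev_XY [simp]: "ev (XY r s) x y = x ^ r * y ^ s"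
  by (simp add: ev_def XY_def poly_monom)

lemma ev_sum [simp]: "ev (sum f A) x y = (\<Sum>i\<in>A. ev (f i) x y)"
  by (induction A rule: infinite_finite_induct) auto

text \<open>For fixed y both sides give the same polynomial in X, the rationals being infinite. So
  \<open>p - q\<close>, read as a polynomial in Y, has all the constants \<open>[:y:]\<close> as
  roots, infinitely many.\<close>

lemma ev_eqI:
  assumes "\<And>x y. ev p x y = ev q x y"
  shows "p = q"
proof (rule ccontr)
  assume "p \<noteq> q"
  have "poly (p - q) [:y:] = 0" for y
  proof -
    have "poly (poly p [:y:]) = poly (poly q [:y:])"
      using assms by (auto simp: ev_def)
    then show ?thesis by (simp add: poly_eq_poly_eq_iff)
  qed
  then have "range (\<lambda>y. [:y:]) \<subseteq> {z. poly (p - q) z = 0}" by auto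
  moreover have "infinite (range (\<lambda>y::rat. [:y:]))"
    by (subst finite_image_iff) (auto simp: inj_on_def infinite_UNIV_char_0)
  ultimately show False
    using poly_roots_finite[of "p - q"] \<open>p \<noteq> q\<close> finite_subset by auto
qed

lemma ev_subst_XY: "ev (subst_XY p A B) x y = ev p (ev A x y) (ev B x y)"
proof -
  \<comment> \<open>The polynomials are nested, so there are two inductions: this one treats a
    coefficient, a polynomial in X; the outer one runs over the powers of Y.\<close>
  have inner: "ev (poly (map_poly (\<lambda>c. [:[:c:]:]) q) A) x y = poly q (ev A x y)" for q
    by (induction q) (auto simp: map_poly_pCons ev_def)
  show ?thesis
  proof (induction p)
    case (pCons q p)
    then show ?case
      using inner[of q] by (simp add: subst_XY_def map_poly_pCons) (simp add: ev_def)
  qed (simp add: subst_XY_def)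
qed

section \<open>Integer matrices by entries and their action on polynomials\<close>

lemma mat2_nth [simp]:
  "mat2 a b c d $ 1 $ 1 = a" "mat2 a b c d $ 1 $ 2 = b"
  "mat2 a b c d $ 2 $ 1 = c" "mat2 a b c d $ 2 $ 2 = d"
  by (simp_all add: mat2_def)

lemma mat2_cases: obtains a b c d where "g = mat2 a b c d"
proof
  show "g = mat2 (g$1$1) (g$1$2) (g$2$1) (g$2$2)"
    by (simp add: vec_eq_iff forall_2)
qed

lemma mat2_mult [simp]: "mat2 a b c d ** mat2 a' b' c' d' =
    mat2 (a * a' + b * c') (a * b' + b * d') (c * a' + d * c') (c * b' + d * d')"
  by (simp add: vec_eq_iff forall_2 matrix_matrix_mult_def sum_2)

lemma mat2_eq_iff: "mat2 a b c d = mat2 a' b' c' d' \<longleftrightarrow> a = a' \<and> b = b' \<and> c = c' \<and> d = d'"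
  by (simp add: vec_eq_iff forall_2)

lemma det_mat2 [simp]: "det (mat2 a b c d) = a * d - b * c"
  by (simp add: det_2)

lemma mat_1_eq_mat2: "mat 1 = mat2 1 0 0 1"
  by (simp add: vec_eq_iff forall_2 mat_def)

lemma ev_poly_slash [simp]: "ev (poly_slash p (mat2 a b c d)) x y =
    ev p (of_int a * x + of_int b * y) (of_int c * x + of_int d * y)"
  by (simp add: poly_slash_def ev_subst_XY)

lemma poly_slash_simps [simp]:
  "poly_slash 0 g = 0" "poly_slash (p + q) g = poly_slash p g + poly_slash q g"
  "poly_slash (p - q) g = poly_slash p g - poly_slash q g" "poly_slash (- p) g = - poly_slash p g"
  "poly_slash (smult [:c:] p) g = smult [:c:] (poly_slash p g)"
  by (cases g rule: mat2_cases, rule ev_eqI, simp)+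

lemma poly_slash_sum [simp]: "poly_slash (sum f A) g = (\<Sum>i\<in>A. poly_slash (f i) g)"
  by (cases g rule: mat2_cases) (rule ev_eqI, simp)

text \<open>Evaluating \<open>poly_slash p g\<close> at a column vector means evaluating
  \<open>p\<close> at its image under \<open>g\<close>. This is a right action of all integer
  matrices, whatever their determinant.\<close>

lemma poly_slash_mult: "poly_slash (poly_slash p g) h = poly_slash p (g ** h)"
  by (cases g rule: mat2_cases, cases h rule: mat2_cases, rule ev_eqI) (simp add: algebra_simps)

lemma poly_slash_1 [simp]: "poly_slash p (mat2 1 0 0 1) = p"
  by (rule ev_eqI) simp

section \<open>Homogeneous polynomials and their monomial basis\<close>

lemma V_closed [intro]:
  "0 \<in> V w" "p \<in> V w \<Longrightarrow> q \<in> V w \<Longrightarrow> p + q \<in> V w" "p \<in> V w \<Longrightarrow> q \<in> V w \<Longrightarrow> p - q \<in> V w"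
  "p \<in> V w \<Longrightarrow> - p \<in> V w"
  "p \<in> V w \<Longrightarrow> smult [:c:] p \<in> V w"
  by (auto simp: V_def) (metis add.right_neutral add_0, metis diff_zero)

lemma V_sum [intro]: "(\<And>i. i \<in> A \<Longrightarrow> f i \<in> V w) \<Longrightarrow> sum f A \<in> V w"
  by (induction A rule: infinite_finite_induct) auto

lemma V_mult:
  assumes "p \<in> V v" "q \<in> V w" shows "p * q \<in> V (v + w)"
  unfolding V_def
proof (intro CollectI allI impI)
  fix r s
  assume "coeff (coeff (p * q) s) r \<noteq> 0"
  then have "(\<Sum>i\<le>s. \<Sum>j\<le>r. coeff (coeff p i) j * coeff (coeff q (s - i)) (r - j)) \<noteq> 0"
    by (simp add: coeff_mult coeff_sum)
  then obtain i j where "i \<le> s" "j \<le> r" "coeff (coeff p i) j * coeff (coeff q (s - i)) (r - j) \<noteq> 0"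
    by (meson atMost_iff sum.not_neutral_contains_not_neutral)
  with assms have "j + i = v" "r - j + (s - i) = w"
    by (auto simp: V_def)
  with \<open>i \<le> s\<close> \<open>j \<le> r\<close> show "r + s = v + w" by linarith
qed

lemma V_power: "p \<in> V v \<Longrightarrow> p ^ n \<in> V (n * v)"
proof (induction n)
  case 0
  have "1 \<in> V 0" by (auto simp: V_def coeff_1 split: if_splits)
  then show ?case by simp
qed (auto intro: V_mult)

lemma coeff_XY: "coeff (coeff (XY r s) s') r' = (if r' = r \<and> s' = s then 1 else 0)"
  by (auto simp: XY_def)

lemma XY_in_V [intro]: "r + s = w \<Longrightarrow> XY r s \<in> V w"
  by (auto simp: V_def coeff_XY split: if_splits)

lemma poly_slash_XY: "poly_slash (XY r s) (mat2 a b c d) =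
    (of_int a * var_X + of_int b * var_Y) ^ r * (of_int c * var_X + of_int d * var_Y) ^ s"
proof (rule ev_eqI)
  have "ev (p ^ n) x y = ev p x y ^ n" for p n x y by (induction n) auto
  then show "ev (poly_slash (XY r s) (mat2 a b c d)) x y =
    ev ((of_int a * var_X + of_int b * var_Y) ^ r * (of_int c * var_X + of_int d * var_Y) ^ s) x y" for x y
    by simp
qed

abbreviation exps :: "nat \<Rightarrow> (nat \<times> nat) set" where "exps w \<equiv> {(r, s). r + s = w}"

lemma finite_exps [simp]: "finite (exps w)"
  by (rule finite_subset[of _ "{..w} \<times> {..w}"]) auto

lemma V_expansion:
  assumes "p \<in> V w"
  shows "p = (\<Sum>(r, s)\<in>exps w. smult [:coeff (coeff p s) r:] (XY r s))"
proof (intro poly_eqI)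
  fix r' s'
  have "coeff (coeff (\<Sum>(r, s)\<in>exps w. smult [:coeff (coeff p s) r:] (XY r s)) s') r' =
     (\<Sum>z\<in>exps w. if z = (r', s') then coeff (coeff p s') r' else 0)"
    unfolding coeff_sum by (rule sum.cong) (auto simp: coeff_XY split: if_splits)
  also have "\<dots> = coeff (coeff p s') r'"
    using assms by (auto simp: V_def sum.delta)
  finally show "coeff (coeff p s') r' = coeff (coeff (\<Sum>(r, s)\<in>exps w. smult [:coeff (coeff p s) r:] (XY r s)) s') r'" ..
qed

text \<open>A monomial goes to a product of powers of two linear forms; \<open>V_expansion\<close>
  extends this by linearity.\<close>

lemma poly_slash_in_V [intro]:
  assumes "p \<in> V w" shows "poly_slash p g \<in> V w"
proof -
  obtain a b c d where g: "g = mat2 a b c d" by (cases g rule: mat2_cases)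
  have lin: "of_int a * var_X + of_int b * var_Y \<in> V 1" for a b
    by (auto simp: V_def var_X_def var_Y_def of_int_poly coeff_pCons split: nat.splits)
  have "poly_slash (XY r s) g \<in> V w" if "r + s = w" for r s
    using V_mult[OF V_power[OF lin[of a b], of r] V_power[OF lin[of c d], of s]] that
    by (simp add: g poly_slash_XY)
  then show ?thesis
    by (subst V_expansion[OF assms]) (auto simp: case_prod_beta intro!: V_sum V_closed)
qed

section \<open>Functions on pairs of residues\<close>

definition act :: "int^2^2 \<Rightarrow> (int \<Rightarrow> int \<Rightarrow> rat poly poly) \<Rightarrow> int \<Rightarrow> int \<Rightarrow> rat poly poly" where
  "act g F = (\<lambda>a b. poly_slash (F (g$1$1 * a + g$1$2 * b) (g$2$1 * a + g$2$2 * b)) g)"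

text \<open>The index is a column vector to which the outer \<open>h\<close> is applied first and
  then \<open>g\<close>; the polynomial is slashed by \<open>g\<close> first and then by
  \<open>h\<close>. Both orders amount to \<open>g ** h\<close>.\<close>

lemma act_act: "act h (act g F) = act (g ** h) F"
  by (cases g rule: mat2_cases, cases h rule: mat2_cases)
     (simp add: act_def poly_slash_mult fun_eq_iff algebra_simps)

lemma act_simps [simp]:
  "act g 0 = 0" "act g (F + G) = act g F + act g G" "act g (F - G) = act g F - act g G"
  "act g (- F) = - act g F"
  by (auto simp: act_def fun_eq_iff)

lemma act_scale: "act g (\<lambda>a b. smult [:c:] (F a b)) = (\<lambda>a b. smult [:c:] (act g F a b))"
  by (simp add: act_def)

lemma act_1 [simp]: "act (mat2 1 0 0 1) F = F"
  by (simp add: act_def)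

section \<open>Unimodular pairs of residues and their symmetries\<close>

definition unimod :: "nat \<Rightarrow> int \<Rightarrow> int \<Rightarrow> bool" where
  "unimod N a b \<longleftrightarrow> gcd a (gcd b (int N)) = 1"

lemma unimod_iff: "unimod N a b \<longleftrightarrow> (\<forall>d. d dvd a \<longrightarrow> d dvd b \<longrightarrow> d dvd int N \<longrightarrow> is_unit d)"
proof -
  have "unimod N a b \<longleftrightarrow> is_unit (gcd a (gcd b (int N)))" by (simp add: unimod_def)
  also have "\<dots> \<longleftrightarrow> (\<forall>d. d dvd a \<longrightarrow> d dvd b \<longrightarrow> d dvd int N \<longrightarrow> is_unit d)"
    by (meson dvd_trans gcd_dvd1 gcd_dvd2 gcd_greatest)
  finally show ?thesis .
qed

text \<open>Multiplying by the adjugate shows that a common divisor of the new pair divides the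
  determinant times the old pair, and the determinant is a unit.\<close>

lemma unimod_transform:
  assumes "is_unit (det (mat2 p q r s))"
  shows "unimod N (p * a + q * b) (r * a + s * b) \<longleftrightarrow> unimod N a b"
proof -
  have "d dvd a \<and> d dvd b" if d: "d dvd p * a + q * b" "d dvd r * a + s * b" for d
  proof -
    have "d dvd s * (p * a + q * b) - q * (r * a + s * b)"
      using d by (intro dvd_diff dvd_mult)
    then have "d dvd (p * s - q * r) * a" by (simp add: algebra_simps)
    moreover have "d dvd p * (r * a + s * b) - r * (p * a + q * b)"
      using d by (intro dvd_diff dvd_mult)
    then have "d dvd (p * s - q * r) * b" by (simp add: algebra_simps)
    ultimately show ?thesis using assms
      by (metis det_mat2 dvd_mult_unit_iff' mult.commute)
  qed
  then show ?thesis unfolding unimod_iff by (meson dvd_add dvd_mult)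
qed

lemma unimod_cong:
  assumes "[a = a'] (mod int N)" "[b = b'] (mod int N)"
  shows "unimod N a b \<longleftrightarrow> unimod N a' b'"
proof -
  have "d dvd a \<longleftrightarrow> d dvd a'" "d dvd b \<longleftrightarrow> d dvd b'" if "d dvd int N" for d
    using assms that by (meson cong_dvd_iff cong_dvd_modulus)+
  then show ?thesis unfolding unimod_iff by meson
qed

lemma unimod_mod [simp]: "unimod N (a mod int N) (b mod int N) \<longleftrightarrow> unimod N a b"
  by (rule unimod_cong) auto

lemma A_set_iff: "(a, b) \<in> A_set N \<longleftrightarrow> a \<in> {0..<int N} \<and> b \<in> {0..<int N} \<and> unimod N a b"
  by (simp add: A_set_def unimod_def)

lemma finite_A_set [simp]: "finite (A_set N)"
  by (rule finite_subset[of _ "{0..<int N} \<times> {0..<int N}"]) (auto simp: A_set_def)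

lemma mod_in_A_set: "N \<ge> 1 \<Longrightarrow> unimod N a b \<Longrightarrow> (a mod int N, b mod int N) \<in> A_set N"
  by (simp add: A_set_iff)

text \<open>Functions of residues are kept as functions on all integers, so that index expressions
  such as \<open>a - b\<close> need no reduction.\<close>

definition periodic :: "nat \<Rightarrow> (int \<Rightarrow> int \<Rightarrow> 'a) \<Rightarrow> bool" where
  "periodic N f \<longleftrightarrow> (\<forall>a b a' b'. [a = a'] (mod int N) \<longrightarrow> [b = b'] (mod int N) \<longrightarrow> f a b = f a' b')"

lemma periodicD: "periodic N f \<Longrightarrow> [a = a'] (mod int N) \<Longrightarrow> [b = b'] (mod int N) \<Longrightarrow> f a b = f a' b'"
  unfolding periodic_def by blast

lemma periodic_mod: "periodic N f \<Longrightarrow> f (a mod int N) (b mod int N) = f a b"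
  by (erule periodicD) auto

text \<open>After reduction modulo N the matrix permutes \<open>A_set N\<close>: the adjugate gives
  injectivity, and the set is finite.\<close>

lemma sum_A_set_transform:
  assumes N: "N \<ge> 1" and f: "periodic N f" and det: "is_unit (det (mat2 p q r s))"
  shows "(\<Sum>(a, b)\<in>A_set N. f (p * a + q * b) (r * a + s * b)) = (\<Sum>(a, b)\<in>A_set N. f a b)"
proof -
  define m where "m = (\<lambda>(a, b). ((p * a + q * b) mod int N, (r * a + s * b) mod int N))"
  have "m ` A_set N \<subseteq> A_set N"
    using N det by (auto simp: m_def A_set_iff unimod_transform)
  moreover have "inj_on m (A_set N)"
  proof (rule inj_onI, clarify)
    fix a b a' b'
    assume ab: "(a, b) \<in> A_set N" "(a', b') \<in> A_set N" and eq: "m (a, b) = m (a', b')"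
    from eq have 1: "int N dvd p * (a - a') + q * (b - b')" and 2: "int N dvd r * (a - a') + s * (b - b')"
      by (simp_all add: m_def mod_eq_dvd_iff algebra_simps)
    have "int N dvd s * (p * (a - a') + q * (b - b')) - q * (r * (a - a') + s * (b - b'))"
      using 1 2 by (intro dvd_diff dvd_mult)
    then have "int N dvd (p * s - q * r) * (a - a')" by (simp add: algebra_simps)
    moreover have "int N dvd p * (r * (a - a') + s * (b - b')) - r * (p * (a - a') + q * (b - b'))"
      using 1 2 by (intro dvd_diff dvd_mult)
    then have "int N dvd (p * s - q * r) * (b - b')" by (simp add: algebra_simps)
    ultimately have "int N dvd a - a'" "int N dvd b - b'" using det
      by (metis det_mat2 dvd_mult_unit_iff' mult.commute)+
    then have "a mod int N = a' mod int N" "b mod int N = b' mod int N"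
      by (simp_all add: mod_eq_dvd_iff)
    with ab show "a = a' \<and> b = b'" by (auto simp: A_set_iff)
  qed
  ultimately have bij: "bij_betw m (A_set N) (A_set N)"
    by (simp add: bij_betw_def endo_inj_surj)
  have "(\<Sum>(a, b)\<in>A_set N. f (p * a + q * b) (r * a + s * b)) = (\<Sum>x\<in>A_set N. (case m x of (a, b) \<Rightarrow> f a b))"
    by (rule sum.cong) (auto simp: m_def periodic_mod[OF f])
  also have "\<dots> = (\<Sum>(a, b)\<in>A_set N. f a b)"
    by (rule sum.reindex_bij_betw[OF bij])
  finally show ?thesis .
qed

text \<open>Vanishing off the unimodular pairs makes equality of these functions on all integers
  agree with equality on the cosets.\<close>

definition index_maps :: "nat \<Rightarrow> nat \<Rightarrow> (int \<Rightarrow> int \<Rightarrow> rat poly poly) set" where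
  "index_maps N w = {F. periodic N F \<and> (\<forall>a b. \<not> unimod N a b \<longrightarrow> F a b = 0) \<and> (\<forall>a b. F a b \<in> V w)}"

lemma index_maps_closed [intro]:
  "0 \<in> index_maps N w" "F \<in> index_maps N w \<Longrightarrow> G \<in> index_maps N w \<Longrightarrow> F + G \<in> index_maps N w"
  "F \<in> index_maps N w \<Longrightarrow> G \<in> index_maps N w \<Longrightarrow> F - G \<in> index_maps N w" "F \<in> index_maps N w \<Longrightarrow> - F \<in> index_maps N w"
  unfolding index_maps_def periodic_def by (auto intro: arg_cong2[of _ _ _ _ "(+)"] arg_cong2[of _ _ _ _ "(-)"])

lemma index_maps_scale [intro]: "F \<in> index_maps N w \<Longrightarrow> (\<lambda>a b. smult [:c:] (F a b)) \<in> index_maps N w"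
  unfolding index_maps_def periodic_def by (auto intro: arg_cong[of _ _ "smult _"])

lemma index_maps_periodic: "F \<in> index_maps N w \<Longrightarrow> periodic N F"
  and index_maps_V: "F \<in> index_maps N w \<Longrightarrow> F a b \<in> V w"
  and index_maps_unimod: "F \<in> index_maps N w \<Longrightarrow> \<not> unimod N a b \<Longrightarrow> F a b = 0"
  by (auto simp: index_maps_def)

lemma act_index_maps [intro]:
  assumes "is_unit (det g)" "F \<in> index_maps N w" shows "act g F \<in> index_maps N w"
proof -
  obtain p q r s where g: "g = mat2 p q r s" by (cases g rule: mat2_cases)
  have "periodic N (act g F)"
    unfolding periodic_def act_def
    by (intro allI impI arg_cong2[of _ _ _ _ poly_slash] refl periodicD[OF index_maps_periodic[OF assms(2)]] cong_add cong_mult)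
       auto
  then show ?thesis
    using assms unimod_transform[of p q r s N] by (auto simp: index_maps_def act_def g)
qed

section \<open>Cosets\<close>

text \<open>The first entry is shifted by N times the product of the primes that divide the second
  entry but not the first. A prime dividing both original entries does not divide N by
  unimodularity, so the shift makes it drop out; any other prime of the second entry divides the
  shift but not the first entry.\<close>

lemma exists_coprime_lift:
  assumes N: "N \<ge> 1" and u: "unimod N a b"
  obtains a' b' where "[a' = a] (mod int N)" "[b' = b] (mod int N)" "coprime a' b'"
proof -
  \<comment> \<open>Zero is replaced by N, so that the second entry has only finitely many prime
    divisors.\<close>
  define b' where "b' = (if b = 0 then int N else b)"
  have b': "[b' = b] (mod int N)" "b' \<noteq> 0" using N by (auto simp: b'_def cong_def)
  define S where "S = {p. prime p \<and> p dvd b' \<and> \<not> p dvd a}"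
  have S: "finite S"
    by (rule finite_subset[of _ "prime_factors b'"]) (use b' in \<open>auto simp: S_def in_prime_factors_iff\<close>)
  define a' where "a' = a + \<Prod>S * int N"
  have "coprime a' b'"
  proof (rule ccontr)
    assume "\<not> coprime a' b'"
    then have "\<not> is_unit (gcd a' b')" by (simp add: coprime_iff_gcd_eq_1)
    moreover have "gcd a' b' \<noteq> 0" using b' by simp
    ultimately obtain p where p: "prime p" "p dvd a'" "p dvd b'"
      by (metis gcd_dvd1 gcd_dvd2 dvd_trans prime_divisor_exists)
    show False
    proof (cases "p dvd a")
      case True
      then have "p dvd \<Prod>S * int N" using p(2) by (simp add: a'_def dvd_add_right_iff)
      moreover have "\<not> p dvd int N"
      proof
        assume pN: "p dvd int N"
        then have "p dvd b" using p(3) b'(1) by (meson cong_dvd_iff cong_dvd_modulus)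
        with True pN u p(1) show False by (auto simp: unimod_iff dest: not_prime_unit)
      qed
      ultimately have "p dvd \<Prod>S" using p(1) by (simp add: prime_dvd_mult_iff)
      then obtain q where "q \<in> S" "p dvd q"
        using p(1) S by (auto simp: prime_dvd_prod_iff)
      then have "p = q" using p(1) by (auto simp: S_def intro: primes_dvd_imp_eq)
      with \<open>q \<in> S\<close> True show False by (simp add: S_def)
    next
      case False
      then have "p dvd \<Prod>S" using p S by (intro dvd_prod_eqI[of S p]) (auto simp: S_def)
      then show False using p(2) False by (simp add: a'_def dvd_add_left_iff)
    qed
  qed
  moreover have "[a' = a] (mod int N)" by (simp add: a'_def cong_def)
  ultimately show thesis using that b'(1) by blast
qed

section \<open>The group SL(2, Z) and the right cosets of \<open>Gamma1 N\<close>\<close>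

lemma carrier_SL2Z [simp]: "g \<in> carrier SL2Z \<longleftrightarrow> det g = 1"
  and mult_SL2Z [simp]: "x \<otimes>\<^bsub>SL2Z\<^esub> y = x ** y"
  and one_SL2Z [simp]: "\<one>\<^bsub>SL2Z\<^esub> = mat2 1 0 0 1"
  by (simp_all add: SL2Z_def mat_1_eq_mat2)

lemma group_SL2Z: "group SL2Z"
proof (rule groupI)
  fix x assume "x \<in> carrier SL2Z"
  then obtain a b c d where "x = mat2 a b c d" "a * d - b * c = 1"
    by (cases x rule: mat2_cases) auto
  then have "mat2 d (- b) (- c) a \<in> carrier SL2Z" "mat2 d (- b) (- c) a \<otimes>\<^bsub>SL2Z\<^esub> x = \<one>\<^bsub>SL2Z\<^esub>"
    by (auto simp: mat2_eq_iff algebra_simps)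
  then show "\<exists>y\<in>carrier SL2Z. y \<otimes>\<^bsub>SL2Z\<^esub> x = \<one>\<^bsub>SL2Z\<^esub>" by blast
qed (auto simp: det_mul matrix_mul_assoc mat_1_eq_mat2[symmetric])

lemma inv_SL2Z:
  assumes "det (mat2 a b c d) = 1"
  shows "inv\<^bsub>SL2Z\<^esub> (mat2 a b c d) = mat2 d (- b) (- c) a"
  by (rule group.inv_equality[OF group_SL2Z])
     (use assms in \<open>auto simp: mat2_eq_iff algebra_simps\<close>)

lemma mat2_in_C_coset: "mat2 p q r s \<in> C_coset N a b \<longleftrightarrow>
    p * s - q * r = 1 \<and> [r = a] (mod int N) \<and> [s = b] (mod int N)"
  by (simp add: C_coset_def)

text \<open>Lift to a coprime bottom row; the Bezout coefficients supply the top row.\<close>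

lemma C_coset_nonempty:
  assumes "N \<ge> 1" "unimod N a b"
  obtains p q r s where "mat2 p q r s \<in> C_coset N a b"
proof -
  obtain r s where rs: "[r = a] (mod int N)" "[s = b] (mod int N)" "coprime r s"
    using exists_coprime_lift[OF assms] .
  obtain x y where "x * r + y * s = 1"
    using bezout_int[of r s] rs(3) by (metis coprime_imp_gcd_eq_1)
  with rs have "mat2 y (- x) r s \<in> C_coset N a b"
    by (simp add: mat2_in_C_coset algebra_simps)
  then show thesis using that by blast
qed

lemma C_coset_cong:
  assumes "[a = a'] (mod int N)" "[b = b'] (mod int N)"
  shows "C_coset N a b = C_coset N a' b'"
  using assms unfolding C_coset_def by (blast intro: cong_trans cong_sym)

lemma C_coset_eqD:
  assumes "N \<ge> 1" "unimod N a b" "C_coset N a b = C_coset N a' b'"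
  shows "[a = a'] (mod int N)" "[b = b'] (mod int N)"
proof -
  obtain p q r s where g: "mat2 p q r s \<in> C_coset N a b"
    using C_coset_nonempty assms(1,2) .
  with assms(3) have "mat2 p q r s \<in> C_coset N a' b'" by simp
  with g show "[a = a'] (mod int N)" "[b = b'] (mod int N)"
    by (auto simp: mat2_in_C_coset intro: cong_trans cong_sym)
qed

lemma unimod_of_det: "p * s - q * r = 1 \<Longrightarrow> unimod N r s"
  unfolding unimod_iff by (metis dvd_diff dvd_mult)

lemma r_coset_Gamma1:
  assumes "det (mat2 a b c d) = 1"
  shows "Gamma1 N #>\<^bsub>SL2Z\<^esub> mat2 a b c d = C_coset N c d"
proof (intro equalityI subsetI)
  fix h assume "h \<in> Gamma1 N #>\<^bsub>SL2Z\<^esub> mat2 a b c d"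
  then obtain g where g: "g \<in> Gamma1 N" "h = g ** mat2 a b c d"
    by (auto simp: r_coset_def)
  obtain p q r s where gm: "g = mat2 p q r s" by (cases g rule: mat2_cases)
  with g(1) have c: "[r = 0] (mod int N)" "[s = 1] (mod int N)" and d: "det g = 1"
    by (auto simp: Gamma1_def)
  have "det h = 1" using d assms unfolding g(2) det_mul by simp
  moreover have "[r * a + s * c = 0 * a + 1 * c] (mod int N)" "[r * b + s * d = 0 * b + 1 * d] (mod int N)"
    using c by (intro cong_add cong_mult; auto)+
  ultimately show "h \<in> C_coset N c d" by (simp add: g(2) gm mat2_in_C_coset)
next
  fix h assume h: "h \<in> C_coset N c d"
  obtain p q r s where hm: "h = mat2 p q r s" by (cases h rule: mat2_cases)
  have c: "[r = c] (mod int N)" "[s = d] (mod int N)" and dh: "p * s - q * r = 1"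
    using h by (auto simp: hm mat2_in_C_coset)
  have dg: "a * d - b * c = 1" using assms by simp
  \<comment> \<open>This is \<open>h\<close> times the inverse of the given matrix. As the bottom
    rows agree modulo N, its bottom row is (0, 1) and its upper left entry is the determinant of
    \<open>h\<close>.\<close>
  let ?g = "mat2 (p * d - q * c) (q * a - p * b) (r * d - s * c) (s * a - r * b)"
  have "[r * d - s * c = c * d - d * c] (mod int N)" "[s * a - r * b = d * a - c * b] (mod int N)"
    "[p * d - q * c = p * s - q * r] (mod int N)"
    using c by (intro cong_diff cong_mult; auto simp: cong_sym_eq)+
  moreover have "d * a - c * b = 1" using dg by (simp add: algebra_simps)
  moreover have "?g = h ** mat2 d (- b) (- c) a" by (simp add: hm)
  then have "det ?g = det h * det (mat2 d (- b) (- c) a)" by (simp only: det_mul)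
  then have "det ?g = 1" using dg dh by (simp add: hm algebra_simps)
  ultimately have "?g \<in> Gamma1 N" using dh by (simp add: Gamma1_def)
  moreover have "h = ?g ** mat2 a b c d"
  proof -
    have "?g ** mat2 a b c d = h ** (mat2 d (- b) (- c) a ** mat2 a b c d)"
      by (simp only: matrix_mul_assoc) (simp add: hm)
    also have "mat2 d (- b) (- c) a ** mat2 a b c d = mat 1"
      using dg by (simp add: mat_1_eq_mat2 mat2_eq_iff algebra_simps)
    finally show ?thesis by simp
  qed
  ultimately show "h \<in> Gamma1 N #>\<^bsub>SL2Z\<^esub> mat2 a b c d"
    unfolding r_coset_def mult_SL2Z by blast
qed

lemma mem_rcosets_Gamma1:
  assumes "N \<ge> 1"
  shows "C \<in> rcosets\<^bsub>SL2Z\<^esub> (Gamma1 N) \<longleftrightarrow> (\<exists>a b. unimod N a b \<and> C = C_coset N a b)"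
proof
  assume "C \<in> rcosets\<^bsub>SL2Z\<^esub> (Gamma1 N)"
  then obtain g where g: "det g = 1" "C = Gamma1 N #>\<^bsub>SL2Z\<^esub> g" by (auto simp: RCOSETS_def)
  obtain a b c d where gm: "g = mat2 a b c d" by (cases g rule: mat2_cases)
  then show "\<exists>a b. unimod N a b \<and> C = C_coset N a b"
    using g r_coset_Gamma1[of a b c d N] unimod_of_det[of a d b c N] by auto
next
  assume "\<exists>a b. unimod N a b \<and> C = C_coset N a b"
  then obtain a b where ab: "unimod N a b" "C = C_coset N a b" by blast
  obtain p q r s where g: "mat2 p q r s \<in> C_coset N a b" using C_coset_nonempty assms ab(1) .
  then have "C = Gamma1 N #>\<^bsub>SL2Z\<^esub> mat2 p q r s"
    using r_coset_Gamma1[of p q r s N] C_coset_cong[of r a N s b] ab(2) by (simp add: mat2_in_C_coset)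
  moreover have "mat2 p q r s \<in> carrier SL2Z" using g by (simp add: mat2_in_C_coset)
  ultimately show "C \<in> rcosets\<^bsub>SL2Z\<^esub> (Gamma1 N)" by (auto simp: RCOSETS_def)
qed

lemma C_coset_translate:
  assumes N: "N \<ge> 1" and u: "unimod N a b" and det: "det (mat2 p q r s) = 1"
  shows "C_coset N a b #>\<^bsub>SL2Z\<^esub> mat2 p q r s = C_coset N (a * p + b * r) (a * q + b * s)"
proof -
  obtain e f c d where g: "mat2 e f c d \<in> C_coset N a b" using C_coset_nonempty N u .
  then have dg: "det (mat2 e f c d) = 1" and cd: "[c = a] (mod int N)" "[d = b] (mod int N)"
    by (auto simp: mat2_in_C_coset)
  have "C_coset N a b = Gamma1 N #>\<^bsub>SL2Z\<^esub> mat2 e f c d"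
    using r_coset_Gamma1[OF dg, of N] C_coset_cong[OF cd] by simp
  moreover have "Gamma1 N \<subseteq> carrier SL2Z" by (auto simp: Gamma1_def)
  ultimately have "C_coset N a b #>\<^bsub>SL2Z\<^esub> mat2 p q r s = Gamma1 N #>\<^bsub>SL2Z\<^esub> (mat2 e f c d ** mat2 p q r s)"
    using group.coset_mult_assoc[OF group_SL2Z, of "Gamma1 N" "mat2 e f c d" "mat2 p q r s"] dg det by simp
  also have "det (mat2 e f c d ** mat2 p q r s) = 1"
    using dg det by (simp only: det_mul)
  then have "Gamma1 N #>\<^bsub>SL2Z\<^esub> (mat2 e f c d ** mat2 p q r s) = C_coset N (c * p + d * r) (c * q + d * s)"
    unfolding mat2_mult by (rule r_coset_Gamma1)
  also have "\<dots> = C_coset N (a * p + b * r) (a * q + b * s)"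
    using cd by (intro C_coset_cong cong_add cong_mult) auto
  finally show ?thesis .
qed

text \<open>The map sends \<open>mat2 p q r s\<close> to \<open>mat2 (- p) q r (- s)\<close> and is
  an involution. The factor \<open>mat_J\<close> moves the sign to the second entry of the bottom
  row.\<close>

lemma C_coset_eps:
  "(\<lambda>g. mat_J ** mat_eps ** g ** mat_eps) ` C_coset N a b = C_coset N a (- b)"
proof (intro equalityI subsetI)
  fix h assume "h \<in> (\<lambda>g. mat_J ** mat_eps ** g ** mat_eps) ` C_coset N a b"
  then obtain g where g: "g \<in> C_coset N a b" "h = mat_J ** mat_eps ** g ** mat_eps" by blast
  obtain p q r s where "g = mat2 p q r s" by (cases g rule: mat2_cases)
  with g show "h \<in> C_coset N a (- b)"
    by (auto simp: mat_J_def mat_eps_def mat2_in_C_coset cong_minus_minus_iff)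
next
  fix h assume h: "h \<in> C_coset N a (- b)"
  obtain p q r s where hm: "h = mat2 p q r s" by (cases h rule: mat2_cases)
  have "mat2 (- p) q r (- s) \<in> C_coset N a b"
    using h cong_minus_minus_iff[of s "- b" "int N"] by (auto simp: hm mat2_in_C_coset)
  moreover have "h = mat_J ** mat_eps ** mat2 (- p) q r (- s) ** mat_eps"
    by (simp add: hm mat_J_def mat_eps_def)
  ultimately show "h \<in> (\<lambda>g. mat_J ** mat_eps ** g ** mat_eps) ` C_coset N a b" by blast
qed

lemma inj_on_C_coset:
  assumes "N \<ge> 1" shows "inj_on (\<lambda>(a, b). C_coset N a b) (A_set N)"
proof (rule inj_onI, clarify)
  fix a b a' b'
  assume ab: "(a, b) \<in> A_set N" "(a', b') \<in> A_set N" "C_coset N a b = C_coset N a' b'"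
  then have "[a = a'] (mod int N)" "[b = b'] (mod int N)"
    using C_coset_eqD[of N a b a' b'] assms by (auto simp: A_set_iff)
  with ab show "a = a' \<and> b = b'" by (auto simp: A_set_iff cong_def)
qed

lemma rcosets_eq_image:
  assumes "N \<ge> 1"
  shows "rcosets\<^bsub>SL2Z\<^esub> (Gamma1 N) = (\<lambda>(a, b). C_coset N a b) ` A_set N"
proof (intro equalityI subsetI)
  fix C assume "C \<in> rcosets\<^bsub>SL2Z\<^esub> (Gamma1 N)"
  then obtain a b where ab: "unimod N a b" "C = C_coset N a b"
    using mem_rcosets_Gamma1 assms by blast
  have "C_coset N (a mod int N) (b mod int N) = C_coset N a b" by (rule C_coset_cong) auto
  with ab show "C \<in> (\<lambda>(a, b). C_coset N a b) ` A_set N"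
    by (intro image_eqI[OF _ mod_in_A_set[OF assms ab(1)]]) simp
next
  fix C assume "C \<in> (\<lambda>(a, b). C_coset N a b) ` A_set N"
  then obtain a b where "C = C_coset N a b" "unimod N a b" by (auto simp: A_set_iff)
  then show "C \<in> rcosets\<^bsub>SL2Z\<^esub> (Gamma1 N)" using mem_rcosets_Gamma1 assms by blast
qed

lemma coset_index_C_coset:
  assumes "N \<ge> 1" "(a, b) \<in> A_set N"
  shows "coset_index N (C_coset N a b) = (a, b)"
  using inv_into_f_f[OF inj_on_C_coset[OF assms(1)] assms(2)] by (simp add: coset_index_def)

text \<open>The twist by \<open>S\<close> in the definition of \<open>\<lambda>\<close> is built in, which turns the coset action
  \<open>C \<mapsto> C\<gamma>\<^sup>-\<^sup>1\<close> into the simultaneous substitution \<open>act\<close>.\<close>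

definition conv :: "nat \<Rightarrow> coset_map \<Rightarrow> int \<Rightarrow> int \<Rightarrow> rat poly poly" where
  "conv N P a b = (if unimod N a b then P (C_coset N b (- a)) else 0)"

lemma unimod_swap_neg [simp]: "unimod N b (- a) \<longleftrightarrow> unimod N a b"
  using unimod_transform[of 0 1 "-1" 0 N a b] by simp

lemma C_coset_in_rcosets: "N \<ge> 1 \<Longrightarrow> unimod N a b \<Longrightarrow> C_coset N b (- a) \<in> rcosets\<^bsub>SL2Z\<^esub> (Gamma1 N)"
  using mem_rcosets_Gamma1[of N] unimod_swap_neg by blast

lemma conv_madd: "N \<ge> 1 \<Longrightarrow> conv N (madd (Gamma1 N) P Q) = conv N P + conv N Q"
  by (auto simp: conv_def madd_def fun_eq_iff C_coset_in_rcosets)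

lemma conv_mscale: "N \<ge> 1 \<Longrightarrow> conv N (mscale (Gamma1 N) c P) = (\<lambda>a b. smult [:c:] (conv N P a b))"
  by (auto simp: conv_def mscale_def fun_eq_iff C_coset_in_rcosets)

lemma conv_mzero: "N \<ge> 1 \<Longrightarrow> conv N (mzero (Gamma1 N)) = 0"
  by (auto simp: conv_def mzero_def fun_eq_iff C_coset_in_rcosets)

text \<open>The row (b, -a) times the inverse of \<open>g\<close> is (b', -a'), where (a', b') is
  the image of the column (a, b) under \<open>g\<close>. So the inverse on cosets becomes
  \<open>g\<close> itself on indices.\<close>

lemma conv_slash:
  assumes N: "N \<ge> 1" and g: "det g = 1"
  shows "conv N (slash (Gamma1 N) P g) = act g (conv N P)"
proof (intro ext)
  fix a b
  obtain p q r s where gm: "g = mat2 p q r s" by (cases g rule: mat2_cases)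
  have u: "unimod N (p * a + q * b) (r * a + s * b) \<longleftrightarrow> unimod N a b"
    by (rule unimod_transform) (use g gm in simp)
  have "C_coset N b (- a) #>\<^bsub>SL2Z\<^esub> inv\<^bsub>SL2Z\<^esub> g = C_coset N (r * a + s * b) (- (p * a + q * b))"
    if "unimod N a b"
    using C_coset_translate[OF N, of b "- a" s "- q" "- r" p] g that inv_SL2Z[of p q r s]
    by (simp add: gm algebra_simps)
  then show "conv N (slash (Gamma1 N) P g) a b = act g (conv N P) a b"
    using u N by (auto simp: conv_def slash_def act_def C_coset_in_rcosets gm)
qed

lemma conv_slash_eps:
  assumes N: "N \<ge> 1"
  shows "conv N (slash_eps (Gamma1 N) P) = act mat_eps (conv N P)"
proof (intro ext)
  fix a b
  have u: "unimod N (- a) b \<longleftrightarrow> unimod N a b"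
    using unimod_transform[of "-1" 0 0 1 N a b] by simp
  then show "conv N (slash_eps (Gamma1 N) P) a b = act mat_eps (conv N P) a b"
    using N by (auto simp: conv_def slash_eps_def act_def C_coset_in_rcosets C_coset_eps)
       (simp_all add: mat_eps_def u)
qed

lemma conv_index_maps:
  assumes N: "N \<ge> 1" and P: "P \<in> rcosets\<^bsub>SL2Z\<^esub> (Gamma1 N) \<rightarrow>\<^sub>E V w"
  shows "conv N P \<in> index_maps N w"
proof -
  have "periodic N (conv N P)"
    unfolding periodic_def conv_def
    by (intro allI impI) (metis C_coset_cong unimod_cong cong_minus_minus_iff)
  then show ?thesis
    using P C_coset_in_rcosets[OF N] by (auto simp: index_maps_def conv_def)
qed

lemma conv_eqI:
  assumes N: "N \<ge> 1" and P: "P \<in> extensional (rcosets\<^bsub>SL2Z\<^esub> (Gamma1 N))"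
    and Q: "Q \<in> extensional (rcosets\<^bsub>SL2Z\<^esub> (Gamma1 N))" and eq: "conv N P = conv N Q"
  shows "P = Q"
proof (rule extensionalityI[OF P Q])
  fix C assume "C \<in> rcosets\<^bsub>SL2Z\<^esub> (Gamma1 N)"
  then obtain a b where ab: "unimod N a b" "C = C_coset N a b"
    using mem_rcosets_Gamma1 N by blast
  then have "unimod N (- b) a" using unimod_swap_neg[of N a "- b"] by simp
  then show "P C = Q C" using fun_cong[OF fun_cong[OF eq], of "- b" a] ab by (simp add: conv_def)
qed

lemma conv_surj:
  assumes N: "N \<ge> 1" and F: "F \<in> index_maps N w"
  obtains P where "P \<in> rcosets\<^bsub>SL2Z\<^esub> (Gamma1 N) \<rightarrow>\<^sub>E V w" "conv N P = F"
proof
  \<comment> \<open>The index is read off the bottom row of an arbitrary representative: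
    \<open>conv\<close> at (a, b) uses the coset with bottom row (b, -a). Periodicity of
    \<open>F\<close> makes the choice immaterial.\<close>
  let ?P = "\<lambda>C\<in>rcosets\<^bsub>SL2Z\<^esub> (Gamma1 N). let g = SOME g. g \<in> C in F (- (g$2$2)) (g$2$1)"
  show "?P \<in> rcosets\<^bsub>SL2Z\<^esub> (Gamma1 N) \<rightarrow>\<^sub>E V w"
    using index_maps_V[OF F] by (auto simp: Let_def)
  show "conv N ?P = F"
  proof (intro ext)
    fix a b
    show "conv N ?P a b = F a b"
    proof (cases "unimod N a b")
      case True
      define g where "g = (SOME g. g \<in> C_coset N b (- a))"
      have "g \<in> C_coset N b (- a)"
        unfolding g_def using C_coset_nonempty[OF N] True by (metis someI unimod_swap_neg)
      then have "[g$2$1 = b] (mod int N)" "[- (g$2$2) = a] (mod int N)"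
        using cong_minus_minus_iff[of "g$2$2" "- a" "int N"] by (auto simp: C_coset_def)
      then have "F (- (g$2$2)) (g$2$1) = F a b"
        by (intro periodicD[OF index_maps_periodic[OF F]])
      then show ?thesis
        using C_coset_in_rcosets[OF N True] True by (simp add: conv_def Let_def g_def)
    qed (simp add: conv_def index_maps_unimod[OF F])
  qed
qed

text \<open>Right multiplication by \<open>mat_S\<close> takes bottom row (a, b) to (b, -a), which
  is exactly where \<open>conv\<close> reads \<open>P\<close>.\<close>

lemma sum_rcosets_conv:
  assumes N: "N \<ge> 1"
  shows "(\<Sum>C\<in>rcosets\<^bsub>SL2Z\<^esub> (Gamma1 N). h (coset_index N C) (P (C #>\<^bsub>SL2Z\<^esub> mat_S))) =
    (\<Sum>(a, b)\<in>A_set N. h (a, b) (conv N P a b))"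
proof -
  have "(\<Sum>C\<in>rcosets\<^bsub>SL2Z\<^esub> (Gamma1 N). h (coset_index N C) (P (C #>\<^bsub>SL2Z\<^esub> mat_S))) =
    (\<Sum>(a, b)\<in>A_set N. h (coset_index N (C_coset N a b)) (P (C_coset N a b #>\<^bsub>SL2Z\<^esub> mat_S)))"
    unfolding rcosets_eq_image[OF N]
    by (subst sum.reindex[OF inj_on_C_coset[OF N]]) (simp add: case_prod_beta o_def)
  also have "\<dots> = (\<Sum>(a, b)\<in>A_set N. h (a, b) (conv N P a b))"
    by (rule sum.cong)
       (auto simp: coset_index_C_coset[OF N] mat_S_def C_coset_translate[OF N] A_set_iff conv_def)
  finally show ?thesis .
qed

lemma extensional_ops [simp]:
  "slash \<Gamma> P g \<in> extensional (rcosets\<^bsub>SL2Z\<^esub> \<Gamma>)" "slash_eps \<Gamma> P \<in> extensional (rcosets\<^bsub>SL2Z\<^esub> \<Gamma>)"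
  "madd \<Gamma> P Q \<in> extensional (rcosets\<^bsub>SL2Z\<^esub> \<Gamma>)" "mscale \<Gamma> c P \<in> extensional (rcosets\<^bsub>SL2Z\<^esub> \<Gamma>)"
  "mzero \<Gamma> \<in> extensional (rcosets\<^bsub>SL2Z\<^esub> \<Gamma>)"
  by (simp_all add: slash_def slash_eps_def madd_def mscale_def mzero_def)

lemma conv_eq_iff:
  assumes "N \<ge> 1" "P \<in> extensional (rcosets\<^bsub>SL2Z\<^esub> (Gamma1 N))" "Q \<in> extensional (rcosets\<^bsub>SL2Z\<^esub> (Gamma1 N))"
  shows "P = Q \<longleftrightarrow> conv N P = conv N Q"
  using conv_eqI[OF assms] by blast

section \<open>The spaces of coset maps described through \<open>conv\<close>\<close>

lemma PiE_iff_conv: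
  assumes N: "N \<ge> 1"
  shows "P \<in> rcosets\<^bsub>SL2Z\<^esub> (Gamma1 N) \<rightarrow>\<^sub>E V w \<longleftrightarrow>
    P \<in> extensional (rcosets\<^bsub>SL2Z\<^esub> (Gamma1 N)) \<and> conv N P \<in> index_maps N w" (is "_ \<longleftrightarrow> ?ext P \<and> _")
proof
  assume "?ext P \<and> conv N P \<in> index_maps N w"
  moreover from this obtain P' where P': "P' \<in> rcosets\<^bsub>SL2Z\<^esub> (Gamma1 N) \<rightarrow>\<^sub>E V w" "conv N P' = conv N P"
    using conv_surj[OF N] by blast
  moreover have "?ext P'" using P'(1) by (simp add: PiE_def)
  ultimately have "P = P'" using conv_eqI[OF N] by metis
  then show "P \<in> rcosets\<^bsub>SL2Z\<^esub> (Gamma1 N) \<rightarrow>\<^sub>E V w" using P'(1) by simp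
qed (use conv_index_maps[OF N] in \<open>auto simp: PiE_def\<close>)

lemma Vbar_iff:
  assumes N: "N \<ge> 1"
  shows "P \<in> Vbar (Gamma1 N) w \<longleftrightarrow> P \<in> extensional (rcosets\<^bsub>SL2Z\<^esub> (Gamma1 N)) \<and> conv N P \<in> index_maps N w \<and>
    act (mat2 (-1) 0 0 (-1)) (conv N P) = conv N P"
  using conv_eq_iff[OF N, of "slash (Gamma1 N) P mat_J" P] conv_slash[OF N, of mat_J P]
  by (auto simp: Vbar_def PiE_iff_conv[OF N] mat_J_def)

lemma Vbar_plus_iff:
  assumes N: "N \<ge> 1"
  shows "P \<in> Vbar_plus (Gamma1 N) w \<longleftrightarrow> P \<in> Vbar (Gamma1 N) w \<and> act (mat2 (-1) 0 0 1) (conv N P) = conv N P"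
  using conv_eq_iff[OF N, of "slash_eps (Gamma1 N) P" P] conv_slash_eps[OF N, of P]
  by (auto simp: Vbar_plus_def Vbar_iff[OF N] mat_eps_def)

lemma Vbar_minus_iff:
  assumes N: "N \<ge> 1"
  shows "P \<in> Vbar_minus (Gamma1 N) w \<longleftrightarrow> P \<in> Vbar (Gamma1 N) w \<and> act (mat2 (-1) 0 0 1) (conv N P) = - conv N P"
proof -
  have "(\<lambda>a b. smult [:- 1:] (conv N P a b)) = - conv N P"
    by (intro ext ev_eqI) simp
  then show ?thesis
    using conv_eq_iff[OF N, of "slash_eps (Gamma1 N) P" "mscale (Gamma1 N) (- 1) P"]
    by (simp add: Vbar_minus_def conv_slash_eps[OF N] conv_mscale[OF N] mat_eps_def)
qed

lemma Vbar_minus_sym_iff: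
  assumes N: "N \<ge> 1"
  shows "P \<in> Vbar_minus_sym (Gamma1 N) w \<longleftrightarrow> P \<in> Vbar_minus (Gamma1 N) w \<and> act (mat2 0 1 1 0) (conv N P) = conv N P"
proof -
  have S: "det mat_S = 1" by (simp add: mat_S_def)
  \<comment> \<open>\<open>mat_eps ** mat_S\<close> is the swap of X and Y.\<close>
  have eq: "conv N (slash (Gamma1 N) (slash_eps (Gamma1 N) P) mat_S) = act (mat2 0 1 1 0) (conv N P)"
    unfolding conv_slash[OF N S] conv_slash_eps[OF N] by (simp add: act_act mat_S_def mat_eps_def)
  show ?thesis
    using conv_eq_iff[OF N, of "slash (Gamma1 N) (slash_eps (Gamma1 N) P) mat_S" P]
    by (auto simp: Vbar_minus_sym_def Vbar_minus_iff[OF N] Vbar_iff[OF N] eq)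
qed

text \<open>The matrices are S, U and the square of U in coordinates.\<close>

lemma Wbar_plus_iff:
  assumes N: "N \<ge> 1"
  shows "P \<in> Wbar_plus (Gamma1 N) w \<longleftrightarrow> P \<in> Vbar_plus (Gamma1 N) w \<and>
    conv N P + act (mat2 0 (-1) 1 0) (conv N P) = 0 \<and>
    conv N P + act (mat2 1 (-1) 1 0) (conv N P) + act (mat2 0 (-1) 1 (-1)) (conv N P) = 0"
proof -
  have d: "det mat_S = 1" "det mat_U = 1" "det (mat_U ** mat_U) = 1" by (simp_all add: mat_S_def mat_U_def)
  show ?thesis
    by (auto simp: Wbar_plus_def Vbar_plus_def conv_eq_iff[OF N, of "madd (Gamma1 N) _ _" "mzero (Gamma1 N)"]
      conv_madd[OF N] conv_mzero[OF N] conv_slash[OF N d(1)] conv_slash[OF N d(2)] conv_slash[OF N d(3)])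
      (simp_all add: mat_S_def mat_U_def)
qed

section \<open>The relations of the double zeta space\<close>

definition lin :: "nat \<Rightarrow> (nat \<Rightarrow> nat \<Rightarrow> (D_gen \<Rightarrow>\<^sub>0 rat)) \<Rightarrow> rat poly poly \<Rightarrow> (D_gen \<Rightarrow>\<^sub>0 rat)" where
  "lin w f p = (\<Sum>(r, s)\<in>exps w. fscale (coeff (coeff p s) r) (f r s))"

lemma lin_simps [simp]:
  "lin w f 0 = 0" "lin w f (p + q) = lin w f p + lin w f q" "lin w f (p - q) = lin w f p - lin w f q"
  "lin w f (- p) = - lin w f p" "lin w f (smult [:c:] p) = fscale c (lin w f p)"
  by (simp_all add: lin_def case_prod_beta formal.scale_left_distrib formal.scale_left_diff_distrib
      sum.distrib sum_subtractf sum_negf formal.scale_sum_right)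

lemma lin_sum [simp]: "lin w f (sum g A) = (\<Sum>i\<in>A. lin w f (g i))"
  by (induction A rule: infinite_finite_induct) auto

lemma lin_XY:
  assumes "r + s = w" shows "lin w f (XY r s) = f r s"
proof -
  have "lin w f (XY r s) = (\<Sum>z\<in>exps w. if z = (r, s) then f r s else 0)"
    unfolding lin_def by (rule sum.cong) (auto simp: coeff_XY split: if_splits)
  also have "\<dots> = f r s" using assms by simp
  finally show ?thesis .
qed

text \<open>Expanding \<open>p\<close> into monomials moves the substitution from the polynomial to
  the values on monomials, ready for comparison with the relators.\<close>

lemma lin_slash:
  assumes "p \<in> V w"
  shows "lin w f (poly_slash p g) = lin w (\<lambda>r s. lin w f (poly_slash (XY r s) g)) p"
proof -
  have "lin w f (poly_slash p g) =
      lin w f (poly_slash (\<Sum>(r, s)\<in>exps w. smult [:coeff (coeff p s) r:] (XY r s)) g)"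
    using V_expansion[OF assms] by simp
  also have "\<dots> = lin w (\<lambda>r s. lin w f (poly_slash (XY r s) g)) p"
    by (simp add: case_prod_beta) (simp add: lin_def case_prod_beta)
  finally show ?thesis .
qed

lemma lin_add: "lin w (\<lambda>r s. f r s + f' r s) p = lin w f p + lin w f' p"
  and lin_diff: "lin w (\<lambda>r s. f r s - f' r s) p = lin w f p - lin w f' p"
  by (simp_all add: lin_def case_prod_beta formal.scale_right_distrib formal.scale_right_diff_distrib
      sum.distrib sum_subtractf)

lemma lin_cong: "(\<And>r s. r + s = w \<Longrightarrow> f r s = f' r s) \<Longrightarrow> lin w f p = lin w f' p"
  unfolding lin_def by (intro sum.cong) auto

lemma lin_in_span: "(\<And>r s. r + s = w \<Longrightarrow> f r s \<in> formal.span X) \<Longrightarrow> lin w f p \<in> formal.span X"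
  unfolding lin_def by (intro formal.span_sum) (auto intro: formal.span_scale)

lemma sum_A_in_span:
  "(\<And>a b. (a, b) \<in> A_set N \<Longrightarrow> f a b \<in> formal.span X) \<Longrightarrow> (\<Sum>(a, b)\<in>A_set N. f a b) \<in> formal.span X"
  by (intro formal.span_sum) auto

section \<open>Pairings of index maps with the generators\<close>

text \<open>The factorials and the shift of exponents by one in \<lambda> are absorbed into the
  generators, so that \<lambda> becomes the plain bilinear pairing.\<close>

definition fZ :: "nat \<Rightarrow> int \<Rightarrow> int \<Rightarrow> nat \<Rightarrow> nat \<Rightarrow> (D_gen \<Rightarrow>\<^sub>0 rat)" where
  "fZ N a b r s = fscale (fact r * fact s) (genZ N a b (r + 1) (s + 1))"
definition fP :: "nat \<Rightarrow> int \<Rightarrow> int \<Rightarrow> nat \<Rightarrow> nat \<Rightarrow> (D_gen \<Rightarrow>\<^sub>0 rat)" where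
  "fP N a b r s = fscale (fact r * fact s) (genP N a b (r + 1) (s + 1))"
definition fS :: "nat \<Rightarrow> int \<Rightarrow> nat \<Rightarrow> nat \<Rightarrow> (D_gen \<Rightarrow>\<^sub>0 rat)" where
  "fS N c r s = fscale (fact r * fact s) (genS N c (r + s + 2))"

lemma periodic_gens:
  assumes "[a = a'] (mod int N)" "[b = b'] (mod int N)"
  shows "fZ N a b = fZ N a' b'" "fP N a b = fP N a' b'" "fS N (a + b) = fS N (a' + b')"
  using assms cong_add[OF assms]
  by (auto simp: fZ_def fP_def fS_def genZ_def genP_def genS_def cong_def fun_eq_iff)

definition pairing :: "nat \<Rightarrow> nat \<Rightarrow> (int \<Rightarrow> int \<Rightarrow> nat \<Rightarrow> nat \<Rightarrow> (D_gen \<Rightarrow>\<^sub>0 rat)) \<Rightarrow>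
    (int \<Rightarrow> int \<Rightarrow> rat poly poly) \<Rightarrow> (D_gen \<Rightarrow>\<^sub>0 rat)" where
  "pairing N w f F = (\<Sum>(a, b)\<in>A_set N. lin w (f a b) (F a b))"

abbreviation "Lam N w \<equiv> pairing N w (fZ N)"
abbreviation "LamP N w \<equiv> pairing N w (fP N)"
abbreviation "LamS N w \<equiv> pairing N w (\<lambda>a b. fS N (a + b))"

lemma pairing_simps [simp]:
  "pairing N w f 0 = 0" "pairing N w f (F + G) = pairing N w f F + pairing N w f G"
  "pairing N w f (F - G) = pairing N w f F - pairing N w f G"
  "pairing N w f (- F) = - pairing N w f F"
  "pairing N w f (\<lambda>a b. smult [:c:] (F a b)) = fscale c (pairing N w f F)"
  by (simp_all add: pairing_def case_prod_beta sum.distrib sum_subtractf sum_negf formal.scale_sum_right)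

lemma pairing_in_span:
  "(\<And>a b r s. (a, b) \<in> A_set N \<Longrightarrow> r + s = w \<Longrightarrow> f a b r s \<in> formal.span X) \<Longrightarrow> pairing N w f F \<in> formal.span X"
  unfolding pairing_def by (intro sum_A_in_span lin_in_span) auto

lemma lam_eq_Lam: "N \<ge> 1 \<Longrightarrow> lam N w P = D_class (w + 2) N (Lam N w (conv N P))"
  using sum_rcosets_conv[of N "\<lambda>z p. case z of (a, b) \<Rightarrow> lin w (fZ N a b) p" P]
  by (simp add: lam_def lam_coset_def pairing_def lin_def fZ_def case_prod_beta)

lemma lamS_eq_LamS: "N \<ge> 1 \<Longrightarrow> lamS N w P = D_class (w + 2) N (LamS N w (conv N P))"
  using sum_rcosets_conv[of N "\<lambda>z p. case z of (a, b) \<Rightarrow> lin w (fS N (a + b)) p" P]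
  by (simp add: lamS_def lamS_coset_def pairing_def lin_def fS_def case_prod_beta)

text \<open>The first expression for \<open>P\<^sub>a\<^sub>,\<^sub>b\<^sup>r\<^sup>,\<^sup>s\<close>, scaled by factorials, is the binomial theorem.\<close>

lemma lin_shift:
  assumes "r + s = w"
  shows "lin w (fZ N a b) (poly_slash (XY r s) (mat2 1 1 0 1)) =
    fscale (fact r * fact s) (\<Sum>j = 0..r. fscale (of_nat ((s + j) choose j)) (genZ N a b (r + 1 - j) (s + 1 + j)))"
proof -
  have "poly_slash (XY r s) (mat2 1 1 0 1) = (\<Sum>j = 0..r. smult [:of_nat (r choose j):] (XY (r - j) (s + j)))"
  proof (rule ev_eqI)
    fix x y :: rat
    have "(x + y) ^ r = (\<Sum>j\<le>r. of_nat (r choose j) * y ^ j * x ^ (r - j))"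
      unfolding add.commute[of x y] binomial_ring ..
    then show "ev (poly_slash (XY r s) (mat2 1 1 0 1)) x y =
        ev (\<Sum>j = 0..r. smult [:of_nat (r choose j):] (XY (r - j) (s + j))) x y"
      by (simp add: sum_distrib_left power_add mult_ac atMost_atLeast0)
  qed
  then have "lin w (fZ N a b) (poly_slash (XY r s) (mat2 1 1 0 1)) =
      (\<Sum>j = 0..r. fscale (of_nat (r choose j)) (fZ N a b (r - j) (s + j)))"
    using assms by (simp add: lin_XY)
  also have "\<dots> = (\<Sum>j = 0..r. fscale (fact r * fact s) (fscale (of_nat ((s + j) choose j)) (genZ N a b (r + 1 - j) (s + 1 + j))))"
  proof (rule sum.cong)
    fix j assume j: "j \<in> {0..r}"
    \<comment> \<open>The factorials turn the binomial coefficient of the expansion into the one of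
      the relation.\<close>
    have "of_nat (r choose j) * (fact (r - j) * fact (s + j)) = (fact r * fact s * of_nat ((s + j) choose j) :: rat)"
      using j by (simp add: binomial_fact)
    then show "fscale (of_nat (r choose j)) (fZ N a b (r - j) (s + j)) =
        fscale (fact r * fact s) (fscale (of_nat ((s + j) choose j)) (genZ N a b (r + 1 - j) (s + 1 + j)))"
      using j by (simp add: fZ_def Suc_diff_le)
  qed simp
  finally show ?thesis by (simp add: formal.scale_sum_right)
qed

lemma poly_slash_XY_swap: "poly_slash (XY r s) (mat2 0 1 1 0) = XY s r"
  by (rule ev_eqI) (simp add: mult.commute)

lemma lin_shift_swap:
  assumes "r + s = w"
  shows "lin w (fZ N a b) (poly_slash (XY r s) (mat2 0 1 1 1)) =
    fscale (fact r * fact s) (\<Sum>j = 0..s. fscale (of_nat ((r + j) choose j)) (genZ N a b (s + 1 - j) (r + 1 + j)))"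
proof -
  have "poly_slash (XY r s) (mat2 0 1 1 1) = poly_slash (XY s r) (mat2 1 1 0 1)"
    using poly_slash_mult[of "XY r s" "mat2 0 1 1 0" "mat2 1 1 0 1"] by (simp add: poly_slash_XY_swap)
  then show ?thesis using lin_shift[of s r w N a b] assms by (simp add: add.commute mult.commute)
qed

section \<open>The relators as identities between pairings\<close>

text \<open>The first family of relators times \<open>fact r * fact s\<close>, with exponents
  shifted by one and both sums written as substitutions; \<open>rel2\<close> does the same for the
  second family.\<close>

definition rel1 :: "nat \<Rightarrow> nat \<Rightarrow> int \<Rightarrow> int \<Rightarrow> nat \<Rightarrow> nat \<Rightarrow> (D_gen \<Rightarrow>\<^sub>0 rat)" where
  "rel1 N w a b r s = fP N a b r s - (lin w (fZ N (a - b) b) (poly_slash (XY r s) (mat2 1 1 0 1))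
     + lin w (fZ N (b - a) a) (poly_slash (XY r s) (mat2 0 1 1 1)))"

definition rel2 :: "nat \<Rightarrow> nat \<Rightarrow> int \<Rightarrow> int \<Rightarrow> nat \<Rightarrow> nat \<Rightarrow> (D_gen \<Rightarrow>\<^sub>0 rat)" where
  "rel2 N w a b r s = fP N a b r s - (fZ N a b r s + lin w (fZ N b a) (poly_slash (XY r s) (mat2 0 1 1 0))
     + fS N (a + b) r s)"

lemma rel_factorial:
  assumes "r + s = w"
  shows "rel1 N w a b r s = fscale (fact r * fact s) (genP N a b (r + 1) (s + 1)
        - ((\<Sum>j = 0..r. fscale (of_nat ((s + j) choose j)) (genZ N (a - b) b (r + 1 - j) (s + 1 + j)))
         + (\<Sum>j = 0..s. fscale (of_nat ((r + j) choose j)) (genZ N (b - a) a (s + 1 - j) (r + 1 + j)))))"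
    and "rel2 N w a b r s = fscale (fact r * fact s) (genP N a b (r + 1) (s + 1)
        - (genZ N a b (r + 1) (s + 1) + genZ N b a (s + 1) (r + 1) + genS N (a + b) (r + 1 + (s + 1))))"
  using assms by (simp_all add: rel1_def rel2_def lin_shift lin_shift_swap poly_slash_XY_swap lin_XY
      fP_def fZ_def fS_def formal.scale_right_diff_distrib formal.scale_right_distrib mult.commute)

lemma D_relators_eq:
  "D_relators (w + 2) N =
     {fscale (1 / (fact r * fact s)) (rel1 N w a b r s) |a b r s. (a, b) \<in> A_set N \<and> r + s = w} \<union>
     {fscale (1 / (fact r * fact s)) (rel2 N w a b r s) |a b r s. (a, b) \<in> A_set N \<and> r + s = w}"
proof -
  have shift: "{f a b r s |a b r s. (a, b) \<in> A_set N \<and> r \<ge> 1 \<and> s \<ge> 1 \<and> r + s = w + 2} =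
      {f a b (r + 1) (s + 1) |a b r s. (a, b) \<in> A_set N \<and> r + s = w}"
    for f :: "int \<Rightarrow> int \<Rightarrow> nat \<Rightarrow> nat \<Rightarrow> (D_gen \<Rightarrow>\<^sub>0 rat)"
  proof (intro equalityI subsetI)
    fix x assume "x \<in> {f a b r s |a b r s. (a, b) \<in> A_set N \<and> r \<ge> 1 \<and> s \<ge> 1 \<and> r + s = w + 2}"
    then obtain a b r s where x: "x = f a b r s" "(a, b) \<in> A_set N" "r \<ge> 1" "s \<ge> 1" "r + s = w + 2"
      by blast
    then have "x = f a b (r - 1 + 1) (s - 1 + 1)" "(r - 1) + (s - 1) = w" by auto
    with x(2) show "x \<in> {f a b (r + 1) (s + 1) |a b r s. (a, b) \<in> A_set N \<and> r + s = w}" by blast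
  qed force
  have coll: "{f a b r s |a b r s. (a, b) \<in> A_set N \<and> r + s = w} = {g a b r s |a b r s. (a, b) \<in> A_set N \<and> r + s = w}"
    if "\<And>a b r s. r + s = w \<Longrightarrow> f a b r s = g a b r s" for f g :: "int \<Rightarrow> int \<Rightarrow> nat \<Rightarrow> nat \<Rightarrow> (D_gen \<Rightarrow>\<^sub>0 rat)"
    by (intro Collect_cong ex_cong1) (simp add: that cong: rev_conj_cong)
  show ?thesis
    unfolding D_relators_def shift
  proof (rule arg_cong2[of _ _ _ _ "(\<union>)"], goal_cases)
    case 1
    show ?case by (rule coll) (simp only: rel_factorial(1), simp)
  next
    case 2
    show ?case by (rule coll) (simp only: rel_factorial(2), simp)
  qed
qed

lemma rel_in_span:
  assumes "(a, b) \<in> A_set N" "r + s = w"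
  shows "rel1 N w a b r s \<in> formal.span (D_relators (w + 2) N)"
    and "rel2 N w a b r s \<in> formal.span (D_relators (w + 2) N)"
proof -
  have "fscale (1 / (fact r * fact s)) (rel1 N w a b r s) \<in> D_relators (w + 2) N"
    "fscale (1 / (fact r * fact s)) (rel2 N w a b r s) \<in> D_relators (w + 2) N"
    using assms unfolding D_relators_eq by blast+
  from this[THEN formal.span_base, THEN formal.span_scale[where c = "fact r * fact s"]]
  show "rel1 N w a b r s \<in> formal.span (D_relators (w + 2) N)"
    "rel2 N w a b r s \<in> formal.span (D_relators (w + 2) N)" by simp_all
qed

text \<open>Adjointness: summing over the permuted pairs moves the matrix off \<open>F\<close>. The
  primed entries form the inverse matrix and act on the indices of the generators.\<close>

lemma pairing_act:
  assumes N: "N \<ge> 1" and F: "F \<in> index_maps N w" and f: "periodic N f" and det: "is_unit (det (mat2 p q r s))"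
    and inv: "mat2 p' q' r' s' ** mat2 p q r s = mat2 1 0 0 1"
  shows "pairing N w f (act (mat2 p q r s) F) =
    pairing N w (\<lambda>a b i j. lin w (f (p' * a + q' * b) (r' * a + s' * b)) (poly_slash (XY i j) (mat2 p q r s))) F"
proof -
  define g where "g = (\<lambda>a b. lin w (f (p' * a + q' * b) (r' * a + s' * b)) (poly_slash (F a b) (mat2 p q r s)))"
  have "periodic N g"
    unfolding periodic_def g_def
    by (intro allI impI arg_cong2[of _ _ _ _ "lin w"] arg_cong2[of _ _ _ _ poly_slash]
      refl periodicD[OF index_maps_periodic[OF F]] periodicD[OF f] cong_add cong_mult) auto
  from sum_A_set_transform[OF N this det]
  have "(\<Sum>(a, b)\<in>A_set N. g (p * a + q * b) (r * a + s * b)) = (\<Sum>(a, b)\<in>A_set N. g a b)" .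
  moreover have "p' * (p * a + q * b) + q' * (r * a + s * b) = a"
    "r' * (p * a + q * b) + s' * (r * a + s * b) = b" for a b
  proof -
    have i: "p' * p + q' * r = 1" "p' * q + q' * s = 0" "r' * p + s' * r = 0" "r' * q + s' * s = 1"
      using inv by (simp_all add: mat2_eq_iff)
    have "p' * (p * a + q * b) + q' * (r * a + s * b) = (p' * p + q' * r) * a + (p' * q + q' * s) * b"
      "r' * (p * a + q * b) + s' * (r * a + s * b) = (r' * p + s' * r) * a + (r' * q + s' * s) * b"
      by (simp_all add: algebra_simps)
    then show "p' * (p * a + q * b) + q' * (r * a + s * b) = a"
      "r' * (p * a + q * b) + s' * (r * a + s * b) = b" by (simp_all add: i)
  qed
  ultimately show ?thesis by (simp add: pairing_def g_def act_def lin_slash[OF index_maps_V[OF F], symmetric])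
qed

lemma pairing_combine:
  "pairing N w (\<lambda>a b r s. f a b r s + g a b r s) F = pairing N w f F + pairing N w g F"
  "pairing N w (\<lambda>a b r s. f a b r s - g a b r s) F = pairing N w f F - pairing N w g F"
  by (simp_all add: pairing_def lin_add lin_diff case_prod_beta sum.distrib sum_subtractf)

lemma pairing_cong:
  "(\<And>a b r s. (a, b) \<in> A_set N \<Longrightarrow> r + s = w \<Longrightarrow> f a b r s = g a b r s) \<Longrightarrow> pairing N w f F = pairing N w g F"
  unfolding pairing_def by (intro sum.cong) (auto intro!: lin_cong)

lemma periodic_scaled_gens: "periodic N (fZ N)" "periodic N (fP N)" "periodic N (\<lambda>a b. fS N (a + b))"
  unfolding periodic_def by (intro allI impI periodic_gens; assumption)+

lemma LamP_relations:
  assumes N: "N \<ge> 1" and F: "F \<in> index_maps N w"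
  shows "LamP N w F - (Lam N w (act (mat2 1 1 0 1) F) + Lam N w (act (mat2 0 1 1 1) F))
      \<in> formal.span (D_relators (w + 2) N)"
    and "LamP N w F - (Lam N w F + Lam N w (act (mat2 0 1 1 0) F) + LamS N w F)
      \<in> formal.span (D_relators (w + 2) N)"
proof -
  have "pairing N w (rel1 N w) F \<in> formal.span (D_relators (w + 2) N)"
    by (rule pairing_in_span) (rule rel_in_span)
  moreover have "pairing N w (rel1 N w) F =
     LamP N w F - (Lam N w (act (mat2 1 1 0 1) F) + Lam N w (act (mat2 0 1 1 1) F))"
    \<comment> \<open>The last four entries invert the first four; they send (a, b) to (a - b, b)
      and to (b - a, a), the lower indices in \<open>rel1\<close>.\<close>
    using pairing_act[OF N F periodic_scaled_gens(1), of 1 1 0 1 1 "-1" 0 1]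
      pairing_act[OF N F periodic_scaled_gens(1), of 0 1 1 1 "-1" 1 1 0]
    by (simp add: rel1_def[abs_def] pairing_combine)
  ultimately show "LamP N w F - (Lam N w (act (mat2 1 1 0 1) F) + Lam N w (act (mat2 0 1 1 1) F))
      \<in> formal.span (D_relators (w + 2) N)" by simp
  have "pairing N w (rel2 N w) F \<in> formal.span (D_relators (w + 2) N)"
    by (rule pairing_in_span) (rule rel_in_span)
  moreover have "pairing N w (rel2 N w) F =
     LamP N w F - (Lam N w F + Lam N w (act (mat2 0 1 1 0) F) + LamS N w F)"
    using pairing_act[OF N F periodic_scaled_gens(1), of 0 1 1 0 0 1 1 0]
    by (simp add: rel2_def[abs_def] pairing_combine)
  ultimately show "LamP N w F - (Lam N w F + Lam N w (act (mat2 0 1 1 0) F) + LamS N w F)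
      \<in> formal.span (D_relators (w + 2) N)" by simp
qed

text \<open>Swap invariance makes the two double terms in each expression for \<open>LamP\<close>
  coincide. The first claim is the difference of the two expressions, the second is one of
  them.\<close>

lemma Lam_symmetric:
  assumes N: "N \<ge> 1" and G: "G \<in> index_maps N w" and sym: "act (mat2 0 1 1 0) G = G"
  shows "fscale 2 (Lam N w (act (mat2 1 1 0 1) G - G)) - LamS N w G \<in> formal.span (D_relators (w + 2) N)"
    and "LamP N w G - (fscale 2 (Lam N w G) + LamS N w G) \<in> formal.span (D_relators (w + 2) N)"
proof -
  have two: "fscale 2 x = x + x" for x :: "D_gen \<Rightarrow>\<^sub>0 rat"
    by (rule poly_mapping_eqI) (simp add: lookup_fscale lookup_add)
  have "act (mat2 0 1 1 1) G = act (mat2 1 1 0 1) (act (mat2 0 1 1 0) G)" by (simp add: act_act)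
  then have eq: "act (mat2 0 1 1 1) G = act (mat2 1 1 0 1) G" by (simp add: sym)
  show "LamP N w G - (fscale 2 (Lam N w G) + LamS N w G) \<in> formal.span (D_relators (w + 2) N)"
    using LamP_relations(2)[OF N G] by (simp add: sym two)
  from formal.span_diff[OF LamP_relations(2)[OF N G] LamP_relations(1)[OF N G]]
  show "fscale 2 (Lam N w (act (mat2 1 1 0 1) G - G)) - LamS N w G \<in> formal.span (D_relators (w + 2) N)"
    by (simp add: sym eq two algebra_simps)
qed

text \<open>The generators depend only on \<open>a + b\<close>, and their weights
  \<open>fact r * fact s\<close> are symmetric in the exponents.\<close>

lemma LamS_swap:
  assumes N: "N \<ge> 1" and F: "F \<in> index_maps N w"
  shows "LamS N w (act (mat2 0 1 1 0) F) = LamS N w F"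
proof -
  have "LamS N w (act (mat2 0 1 1 0) F) = pairing N w (\<lambda>a b i j. lin w (fS N (b + a)) (poly_slash (XY i j) (mat2 0 1 1 0))) F"
    using pairing_act[OF N F periodic_scaled_gens(3), of 0 1 1 0 0 1 1 0] by simp
  also have "\<dots> = LamS N w F"
    by (rule pairing_cong) (simp add: poly_slash_XY_swap lin_XY fS_def add.commute mult.commute)
  finally show ?thesis .
qed

section \<open>Sign changes and the even subspace\<close>

lemma poly_slash_XY_signs:
  "poly_slash (XY r s) (mat2 (-1) 0 0 1) = smult [:(-1) ^ r:] (XY r s)"
  "poly_slash (XY r s) (mat2 1 0 0 (-1)) = smult [:(-1) ^ s:] (XY r s)"
  "poly_slash (XY r s) (mat2 (-1) 0 0 (-1)) = smult [:(-1) ^ (r + s):] (XY r s)"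
proof -
  show "poly_slash (XY r s) (mat2 (-1) 0 0 1) = smult [:(-1) ^ r:] (XY r s)"
  proof (rule ev_eqI)
    fix x y
    show "ev (poly_slash (XY r s) (mat2 (-1) 0 0 1)) x y = ev (smult [:(-1) ^ r:] (XY r s)) x y"
      by (simp add: power_minus[of x r])
  qed
  show "poly_slash (XY r s) (mat2 1 0 0 (-1)) = smult [:(-1) ^ s:] (XY r s)"
  proof (rule ev_eqI)
    fix x y
    show "ev (poly_slash (XY r s) (mat2 1 0 0 (-1))) x y = ev (smult [:(-1) ^ s:] (XY r s)) x y"
      by (simp add: power_minus[of y s])
  qed
  show "poly_slash (XY r s) (mat2 (-1) 0 0 (-1)) = smult [:(-1) ^ (r + s):] (XY r s)"
  proof (rule ev_eqI)
    fix x y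
    show "ev (poly_slash (XY r s) (mat2 (-1) 0 0 (-1))) x y = ev (smult [:(-1) ^ (r + s):] (XY r s)) x y"
      by (simp add: power_minus[of x r] power_minus[of y s] power_add)
  qed
qed

lemma LamP_signs_in_span:
  assumes N: "N \<ge> 1" and F: "F \<in> index_maps N w"
  shows "LamP N w (F - act (mat2 (-1) 0 0 1) F - act (mat2 1 0 0 (-1)) F + act (mat2 (-1) 0 0 (-1)) F)
    \<in> formal.span (P_ev_gens (w + 2) N)"
proof -
  let ?f = "\<lambda>a b r s. fP N a b r s - fscale ((-1) ^ r) (fP N (- a) b r s) - fscale ((-1) ^ s) (fP N a (- b) r s)
    + fscale ((-1) ^ (r + s)) (fP N (- a) (- b) r s)"
  have act: "LamP N w (act (mat2 (-1) 0 0 1) F) = pairing N w (\<lambda>a b r s. fscale ((-1) ^ r) (fP N (- a) b r s)) F"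
    "LamP N w (act (mat2 1 0 0 (-1)) F) = pairing N w (\<lambda>a b r s. fscale ((-1) ^ s) (fP N a (- b) r s)) F"
    "LamP N w (act (mat2 (-1) 0 0 (-1)) F) = pairing N w (\<lambda>a b r s. fscale ((-1) ^ (r + s)) (fP N (- a) (- b) r s)) F"
    using pairing_act[OF N F periodic_scaled_gens(2), of "-1" 0 0 1 "-1" 0 0 1]
      pairing_act[OF N F periodic_scaled_gens(2), of 1 0 0 "-1" 1 0 0 "-1"]
      pairing_act[OF N F periodic_scaled_gens(2), of "-1" 0 0 "-1" "-1" 0 0 "-1"]
    by (auto simp: poly_slash_XY_signs lin_XY intro!: pairing_cong)
  have "?f a b r s \<in> formal.span (P_ev_gens (w + 2) N)" if "(a, b) \<in> A_set N" "r + s = w" for a b r s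
  proof -
    \<comment> \<open>Exponents of generators exceed those of monomials by one, so the single sign
      changes enter with a minus and the double one with a plus.\<close>
    let ?r = "r + 1" and ?s = "s + 1"
    let ?g = "genP N a b ?r ?s + fscale ((-1) ^ ?r) (genP N (- a) b ?r ?s)
      + fscale ((-1) ^ ?s) (genP N a (- b) ?r ?s) + fscale ((-1) ^ (?r + ?s)) (genP N (- a) (- b) ?r ?s)"
    have "?r \<ge> 1" "?s \<ge> 1" "?r + ?s = w + 2" using that by auto
    with that(1) have "?g \<in> P_ev_gens (w + 2) N" unfolding P_ev_gens_def by blast
    then have "fscale (fact r * fact s) ?g \<in> formal.span (P_ev_gens (w + 2) N)"
      by (intro formal.span_scale formal.span_base)
    also have "fscale (fact r * fact s) ?g = ?f a b r s"
      by (simp add: fP_def formal.scale_right_distrib formal.scale_right_diff_distrib mult.commute)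
    finally show ?thesis .
  qed
  then have "pairing N w ?f F \<in> formal.span (P_ev_gens (w + 2) N)"
    by (rule pairing_in_span)
  then show ?thesis by (simp add: pairing_combine act)
qed

text \<open>Invariance under -I lets the pairing be averaged over c and -c, which produces the
  generators of the even subspace.\<close>

lemma LamS_in_span:
  assumes N: "N \<ge> 1" and F: "F \<in> index_maps N w" and J: "act (mat2 (-1) 0 0 (-1)) F = F"
  shows "LamS N w F \<in> formal.span (P_ev_gens (w + 2) N)"
proof -
  let ?f = "\<lambda>a b r s. fS N (a + b) r s + fscale ((-1) ^ (r + s)) (fS N (- a - b) r s)"
  have act: "LamS N w (act (mat2 (-1) 0 0 (-1)) F) = pairing N w (\<lambda>a b r s. fscale ((-1) ^ (r + s)) (fS N (- a - b) r s)) F"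
    using pairing_act[OF N F periodic_scaled_gens(3), of "-1" 0 0 "-1" "-1" 0 0 "-1"]
    by (auto simp: poly_slash_XY_signs lin_XY intro!: pairing_cong)
  have "?f a b r s \<in> formal.span (P_ev_gens (w + 2) N)" if "(a, b) \<in> A_set N" "r + s = w" for a b r s
  proof -
    \<comment> \<open>\<open>P_ev_gens\<close> takes its index among the representatives below
      N.\<close>
    define c where "c = (a + b) mod int N"
    have "c \<in> {0..<int N}" using N by (simp add: c_def)
    then have "genS N c (w + 2) + fscale ((-1) ^ (w + 2)) (genS N (- c) (w + 2)) \<in> P_ev_gens (w + 2) N"
      unfolding P_ev_gens_def by blast
    then have "fscale (fact r * fact s) (genS N c (w + 2) + fscale ((-1) ^ (w + 2)) (genS N (- c) (w + 2)))
      \<in> formal.span (P_ev_gens (w + 2) N)"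
      by (intro formal.span_scale formal.span_base)
    moreover have "genS N c = genS N (a + b)" "genS N (- c) = genS N (- a - b)"
      by (simp_all add: c_def genS_def fun_eq_iff mod_minus_eq)
    ultimately show ?thesis
      using that by (simp add: fS_def formal.scale_right_distrib mult.commute)
  qed
  then have "pairing N w ?f F \<in> formal.span (P_ev_gens (w + 2) N)"
    by (rule pairing_in_span)
  then have "fscale (1/2) (LamS N w F + LamS N w F) \<in> formal.span (P_ev_gens (w + 2) N)"
    using act J by (intro formal.span_scale) (simp add: pairing_combine)
  moreover have "fscale (1/2) (x + x) = x" for x :: "D_gen \<Rightarrow>\<^sub>0 rat"
    by (rule poly_mapping_eqI) (simp add: lookup_fscale lookup_add)
  ultimately show ?thesis by simp
qed

section \<open>Recovering a function from its pairing\<close>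

lemma fZ_formal: "unimod N a b \<Longrightarrow> N \<ge> 1 \<Longrightarrow> fZ N a b r s \<in> formal_space (r + s + 2) N"
  and fS_formal: "N \<ge> 1 \<Longrightarrow> fS N c r s \<in> formal_space (r + s + 2) N"
  by (auto simp: formal_space_def D_gens_def fZ_def fS_def genZ_def genS_def A_set_iff in_keys_iff
      lookup_fscale lookup_single when_def split: if_splits)

lemma span_formal_space: "formal.span (formal_space k N) = formal_space k N"
proof -
  have "x \<in> formal_space k N \<longleftrightarrow> (\<forall>g. g \<notin> D_gens k N \<longrightarrow> poly_mapping.lookup x g = 0)" for x
    by (auto simp: formal_space_def in_keys_iff)
  then have "formal.subspace (formal_space k N)"
    by (simp add: formal.subspace_def lookup_fscale lookup_add)
  then show ?thesis by (simp only: formal.span_eq_iff)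
qed

lemma pairing_formal:
  assumes "\<And>a b r s. (a, b) \<in> A_set N \<Longrightarrow> r + s = w \<Longrightarrow> f a b r s \<in> formal_space (w + 2) N"
  shows "pairing N w f F \<in> formal_space (w + 2) N"
  using pairing_in_span[of N w f "formal_space (w + 2) N" F] assms unfolding span_formal_space by blast

lemma Lam_formal: "N \<ge> 1 \<Longrightarrow> Lam N w F \<in> formal_space (w + 2) N"
  and LamS_formal: "N \<ge> 1 \<Longrightarrow> LamS N w F \<in> formal_space (w + 2) N"
  by (rule pairing_formal; use fZ_formal fS_formal in \<open>force simp: A_set_iff\<close>)+

lemma smult_const_1 [simp]: "smult [:1:] p = p" for p :: "rat poly poly"
  by (rule ev_eqI) simp

text \<open>A one-sided inverse of \<^term>\<open>Lam N w\<close>. Its values on the symbols \<open>P\<^sub>a\<^sub>,\<^sub>b\<^sup>r\<^sup>,\<^sup>s\<close> and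
  \<open>Z\<^sub>c\<^sup>k\<close> are chosen so that it kills the second family of relators.\<close>

definition Lam_inv :: "nat \<Rightarrow> nat \<Rightarrow> (D_gen \<Rightarrow>\<^sub>0 rat) \<Rightarrow> int \<Rightarrow> int \<Rightarrow> rat poly poly" where
  "Lam_inv N w x a b = (if unimod N a b then \<Sum>(r, s)\<in>exps w.
     smult [:(poly_mapping.lookup x (GZ (a mod int N) (b mod int N) (r + 1) (s + 1)) +
       poly_mapping.lookup x (GP (a mod int N) (b mod int N) (r + 1) (s + 1)) +
       poly_mapping.lookup x (GP (b mod int N) (a mod int N) (s + 1) (r + 1))) / (fact r * fact s):] (XY r s) else 0)"

lemma Lam_inv_simps [simp]:
  "Lam_inv N w 0 = 0"
  "Lam_inv N w (x + y) = Lam_inv N w x + Lam_inv N w y"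
  "Lam_inv N w (x - y) = Lam_inv N w x - Lam_inv N w y"
  "Lam_inv N w (fscale c x) = (\<lambda>a b. smult [:c:] (Lam_inv N w x a b))"
proof -
  show "Lam_inv N w 0 = 0" by (auto simp: Lam_inv_def fun_eq_iff case_prod_beta)
  show add: "Lam_inv N w (x + y) = Lam_inv N w x + Lam_inv N w y" for x y
  proof (intro ext)
    fix a b show "Lam_inv N w (x + y) a b = (Lam_inv N w x + Lam_inv N w y) a b"
      by (auto simp: Lam_inv_def case_prod_beta lookup_add add_divide_distrib sum.distrib intro!: ev_eqI)
         (simp add: sum.distrib[symmetric] algebra_simps)
  qed
  show scale: "Lam_inv N w (fscale c x) = (\<lambda>a b. smult [:c:] (Lam_inv N w x a b))" for c x
  proof (intro ext)
    fix a b show "Lam_inv N w (fscale c x) a b = smult [:c:] (Lam_inv N w x a b)"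
      by (auto simp: Lam_inv_def case_prod_beta lookup_fscale intro!: ev_eqI)
         (simp add: sum_distrib_left algebra_simps add_divide_distrib)
  qed
  have "x - y = x + fscale (- 1) y"
    by (rule poly_mapping_eqI) (simp add: lookup_fscale lookup_add lookup_minus)
  then have eq: "Lam_inv N w (x - y) = Lam_inv N w x + (\<lambda>a b. smult [:- 1:] (Lam_inv N w y a b))"
    by (simp only: add scale)
  show "Lam_inv N w (x - y) = Lam_inv N w x - Lam_inv N w y"
    unfolding eq by (intro ext ev_eqI) simp
qed

lemma Lam_inv_sum: "Lam_inv N w (sum f A) a b = (\<Sum>i\<in>A. Lam_inv N w (f i) a b)"
  by (induction A rule: infinite_finite_induct) auto

section \<open>Index maps supported on one pair of residues, and the values of
  \<open>Lam_inv\<close>\<close>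

definition Delta :: "nat \<Rightarrow> int \<Rightarrow> int \<Rightarrow> rat poly poly \<Rightarrow> int \<Rightarrow> int \<Rightarrow> rat poly poly" where
  "Delta N a0 b0 p a b = (if [a = a0] (mod int N) \<and> [b = b0] (mod int N) then p else 0)"

lemma Delta_index_maps:
  assumes "unimod N a0 b0" "p \<in> V w" shows "Delta N a0 b0 p \<in> index_maps N w"
proof -
  have "periodic N (Delta N a0 b0 p)"
    by (simp add: periodic_def Delta_def cong_def)
  moreover have "unimod N a b" if "[a = a0] (mod int N)" "[b = b0] (mod int N)" for a b
    using unimod_cong[OF that] assms(1) by simp
  ultimately show ?thesis using assms(2) by (auto simp: index_maps_def Delta_def)
qed

text \<open>Acting by a matrix moves the support by its inverse, given by the primed
  entries.\<close>

lemma act_Delta: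
  assumes "mat2 p' q' r' s' ** mat2 p q r s = mat2 1 0 0 1" "mat2 p q r s ** mat2 p' q' r' s' = mat2 1 0 0 1"
  shows "act (mat2 p q r s) (Delta N a0 b0 P) = Delta N (p' * a0 + q' * b0) (r' * a0 + s' * b0) (poly_slash P (mat2 p q r s))"
proof (intro ext)
  fix a b
  have step: "[k * c + l * d = k * x + l * y] (mod int N)"
    if "[c = x] (mod int N)" "[d = y] (mod int N)" for c d k l x y
    using that by (intro cong_add cong_mult) auto
  have inv: "p' * (p * x + q * y) + q' * (r * x + s * y) = x \<and> r' * (p * x + q * y) + s' * (r * x + s * y) = y"
    if "mat2 p' q' r' s' ** mat2 p q r s = mat2 1 0 0 1" for p q r s p' q' r' s' x y
  proof -
    have "p' * p + q' * r = 1" "p' * q + q' * s = 0" "r' * p + s' * r = 0" "r' * q + s' * s = 1"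
      using that by (simp_all add: mat2_eq_iff)
    moreover have "p' * (p * x + q * y) + q' * (r * x + s * y) = (p' * p + q' * r) * x + (p' * q + q' * s) * y"
      "r' * (p * x + q * y) + s' * (r * x + s * y) = (r' * p + s' * r) * x + (r' * q + s' * s) * y"
      by (simp_all add: algebra_simps)
    ultimately show ?thesis by simp
  qed
  have "[p * a + q * b = a0] (mod int N) \<and> [r * a + s * b = b0] (mod int N) \<longleftrightarrow>
      [a = p' * a0 + q' * b0] (mod int N) \<and> [b = r' * a0 + s' * b0] (mod int N)"
    using step[of "p * a + q * b" a0 "r * a + s * b" b0 p' q'] step[of "p * a + q * b" a0 "r * a + s * b" b0 r' s']
      step[of a "p' * a0 + q' * b0" b "r' * a0 + s' * b0" p q] step[of a "p' * a0 + q' * b0" b "r' * a0 + s' * b0" r s]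
      inv[OF assms(1), of a b] inv[OF assms(2), of a0 b0] by metis
  then show "act (mat2 p q r s) (Delta N a0 b0 P) a b =
      Delta N (p' * a0 + q' * b0) (r' * a0 + s' * b0) (poly_slash P (mat2 p q r s)) a b"
    by (simp add: act_def Delta_def)
qed

lemma Lam_inv_fZ:
  assumes "unimod N a0 b0" "r + s = w"
  shows "Lam_inv N w (fZ N a0 b0 r s) = Delta N a0 b0 (XY r s)"
proof (intro ext)
  fix a b
  show "Lam_inv N w (fZ N a0 b0 r s) a b = Delta N a0 b0 (XY r s) a b"
  proof (cases "unimod N a b")
    case True
    have "Lam_inv N w (fZ N a0 b0 r s) a b = (\<Sum>z\<in>exps w. if z = (r, s) then Delta N a0 b0 (XY r s) a b else 0)"
      unfolding Lam_inv_def if_P[OF True]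
      by (rule sum.cong) (auto simp: fZ_def genZ_def lookup_fscale lookup_single when_def Delta_def cong_def split: if_splits)
    then show ?thesis using assms(2) by simp
  next
    case False
    then show ?thesis using unimod_cong[of a a0 N b b0] assms(1) by (auto simp: Lam_inv_def Delta_def)
  qed
qed

lemma Lam_inv_fP:
  assumes "unimod N a0 b0" "r + s = w"
  shows "Lam_inv N w (fP N a0 b0 r s) = Delta N a0 b0 (XY r s) + Delta N b0 a0 (XY s r)"
proof (intro ext)
  fix a b
  show "Lam_inv N w (fP N a0 b0 r s) a b = (Delta N a0 b0 (XY r s) + Delta N b0 a0 (XY s r)) a b"
  proof (cases "unimod N a b")
    case True
    \<comment> \<open>The two contributions are kept apart: both occur at the same place when the
      residues of \<open>a0\<close> and \<open>b0\<close> agree and \<open>r = s\<close>.\<close>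
    have "Lam_inv N w (fP N a0 b0 r s) a b = (\<Sum>z\<in>exps w. (if z = (r, s) then Delta N a0 b0 (XY r s) a b else 0)
        + (if z = (s, r) then Delta N b0 a0 (XY s r) a b else 0))"
      unfolding Lam_inv_def if_P[OF True]
    proof (rule sum.cong, goal_cases)
      case (2 z)
      obtain i j where z: "z = (i, j)" by (cases z)
      \<comment> \<open>The 0 stands for the \<open>GZ\<close> coefficient, which vanishes on
        \<open>fP\<close>.\<close>
      have split: "smult [:(0 + x + y) / d:] p = smult [:x / d:] p + smult [:y / d:] p"
        for x y d :: rat and p :: "rat poly poly"
        by (rule ev_eqI) (simp add: add_divide_distrib algebra_simps)
      have "poly_mapping.lookup (fP N a0 b0 r s) (GZ (a mod int N) (b mod int N) (i + 1) (j + 1)) = 0"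
        by (simp add: fP_def genP_def lookup_fscale lookup_single)
      moreover have "smult [:poly_mapping.lookup (fP N a0 b0 r s) (GP (a mod int N) (b mod int N) (i + 1) (j + 1)) /
          (fact i * fact j):] (XY i j) = (if z = (r, s) then Delta N a0 b0 (XY r s) a b else 0)"
        by (auto simp: fP_def genP_def lookup_fscale lookup_single when_def Delta_def cong_def z)
      moreover have "smult [:poly_mapping.lookup (fP N a0 b0 r s) (GP (b mod int N) (a mod int N) (j + 1) (i + 1)) /
          (fact i * fact j):] (XY i j) = (if z = (s, r) then Delta N b0 a0 (XY s r) a b else 0)"
        by (auto simp: fP_def genP_def lookup_fscale lookup_single when_def Delta_def cong_def z mult.commute)
      ultimately show ?case by (simp only: z prod.case split)
    qed simp
    also have "\<dots> = (\<Sum>z\<in>exps w. if z = (r, s) then Delta N a0 b0 (XY r s) a b else 0)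
        + (\<Sum>z\<in>exps w. if z = (s, r) then Delta N b0 a0 (XY s r) a b else 0)"
      by (rule sum.distrib)
    finally show ?thesis using assms(2) by simp
  next
    case False
    then show ?thesis using unimod_cong[of a a0 N b b0] unimod_cong[of a b0 N b a0] assms(1)
        unimod_transform[of 0 1 1 0 N a0 b0] by (auto simp: Lam_inv_def Delta_def)
  qed
qed

lemma Lam_inv_genS [simp]: "Lam_inv N w (genS N c k) = 0"
  by (auto simp: Lam_inv_def genS_def lookup_single when_def fun_eq_iff case_prod_beta)

lemma Delta_simps [simp]:
  "Delta N a0 b0 0 = 0"
  "smult [:c:] (Delta N a0 b0 p a b) = Delta N a0 b0 (smult [:c:] p) a b"
  by (auto simp: Delta_def fun_eq_iff)

lemma Delta_sum: "Delta N a0 b0 (sum f A) a b = (\<Sum>i\<in>A. Delta N a0 b0 (f i) a b)"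
proof (cases "[a = a0] (mod int N) \<and> [b = b0] (mod int N)")
  case False
  show ?thesis unfolding Delta_def if_not_P[OF False] by simp
qed (simp add: Delta_def)

lemma Lam_inv_lin_fZ:
  assumes "unimod N a0 b0" "p \<in> V w"
  shows "Lam_inv N w (lin w (fZ N a0 b0) p) = Delta N a0 b0 p"
proof (intro ext)
  fix a b
  have "Lam_inv N w (lin w (fZ N a0 b0) p) a b =
      (\<Sum>(r, s)\<in>exps w. Delta N a0 b0 (smult [:coeff (coeff p s) r:] (XY r s)) a b)"
    unfolding lin_def Lam_inv_sum by (rule sum.cong) (auto simp: Lam_inv_fZ assms(1))
  also have "\<dots> = Delta N a0 b0 (\<Sum>(r, s)\<in>exps w. smult [:coeff (coeff p s) r:] (XY r s)) a b"
    by (simp add: Delta_sum case_prod_beta del: Delta_simps)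
  finally show "Lam_inv N w (lin w (fZ N a0 b0) p) a b = Delta N a0 b0 p a b"
    using V_expansion[OF assms(2)] by simp
qed

lemma Lam_inv_Lam:
  assumes N: "N \<ge> 1" and F: "F \<in> index_maps N w"
  shows "Lam_inv N w (Lam N w F) = F"
proof (intro ext)
  fix a b
  have "Lam_inv N w (Lam N w F) a b = (\<Sum>(a0, b0)\<in>A_set N. Delta N a0 b0 (F a0 b0) a b)"
    unfolding pairing_def Lam_inv_sum by (rule sum.cong) (auto simp: Lam_inv_lin_fZ A_set_iff index_maps_V[OF F])
  also have "\<dots> = (\<Sum>z\<in>A_set N. if z = (a mod int N, b mod int N) then F a b else 0)"
  proof (rule sum.cong)
    fix z assume z: "z \<in> A_set N"
    obtain a0 b0 where [simp]: "z = (a0, b0)" by (cases z)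
    have "[a = a0] (mod int N) \<and> [b = b0] (mod int N) \<longleftrightarrow> z = (a mod int N, b mod int N)"
      using z by (auto simp: A_set_iff cong_def)
    then show "(case z of (a0, b0) \<Rightarrow> Delta N a0 b0 (F a0 b0) a b) = (if z = (a mod int N, b mod int N) then F a b else 0)"
      using periodic_mod[OF index_maps_periodic[OF F], of a b] by (auto simp: Delta_def)
  qed simp
  also have "\<dots> = F a b"
    using mod_in_A_set[OF N, of a b] index_maps_unimod[OF F, of a b] by (auto simp: A_set_iff)
  finally show "Lam_inv N w (Lam N w F) a b = F a b" .
qed

text \<open>A relator of the second family goes to 0. One of the first family gives the symmetric
  function G carried by (a, b) and (b, a), minus its shift by T; the property is linear in
  \<open>x\<close>.\<close>

lemma Lam_inv_span_relators:
  assumes N: "N \<ge> 1" and "x \<in> formal.span (D_relators (w + 2) N)"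
  shows "\<exists>G\<in>index_maps N w. act (mat2 0 1 1 0) G = G \<and> Lam_inv N w x = G - act (mat2 1 1 0 1) G"
  using assms(2)
proof (induction x rule: formal.span_induct_alt)
  case base
  show ?case by (rule bexI[of _ 0]) (simp_all add: index_maps_closed act_def)
next
  case (step c x y)
  let ?sym = "\<lambda>x. \<exists>G\<in>index_maps N w. act (mat2 0 1 1 0) G = G \<and> Lam_inv N w x = G - act (mat2 1 1 0 1) G"
  have scale: "?sym (fscale c x)" if "?sym x" for c x
  proof -
    obtain G where G: "G \<in> index_maps N w" "act (mat2 0 1 1 0) G = G" "Lam_inv N w x = G - act (mat2 1 1 0 1) G"
      using \<open>?sym x\<close> by blast
    let ?G = "\<lambda>a b. smult [:c:] (G a b)"
    have "act (mat2 0 1 1 0) ?G = ?G" by (simp add: act_scale G(2))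
    moreover have "Lam_inv N w (fscale c x) = ?G - act (mat2 1 1 0 1) ?G"
      by (simp add: G(3) act_scale fun_eq_iff smult_diff_right)
    ultimately show ?thesis using G(1) by blast
  qed
  have add: "?sym (x + y)" if "?sym x" "?sym y" for x y
  proof -
    obtain G H where "G \<in> index_maps N w" "act (mat2 0 1 1 0) G = G" "Lam_inv N w x = G - act (mat2 1 1 0 1) G"
      "H \<in> index_maps N w" "act (mat2 0 1 1 0) H = H" "Lam_inv N w y = H - act (mat2 1 1 0 1) H"
      using \<open>?sym x\<close> \<open>?sym y\<close> by blast
    then show ?thesis by (intro bexI[of _ "G + H"]) auto
  qed
  have rel1: "?sym (rel1 N w a b r s)" if "(a, b) \<in> A_set N" and rs: "r + s = w" for a b r s
  proof -
    have u: "unimod N a b" "unimod N b a" "unimod N (a - b) b" "unimod N (b - a) a"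
      using that unimod_transform[of 0 1 1 0 N a b] unimod_transform[of 1 "-1" 0 1 N a b]
        unimod_transform[of "-1" 1 1 0 N a b] by (auto simp: A_set_iff)
    let ?G = "Delta N a b (XY r s) + Delta N b a (XY s r)"
    have "?G \<in> index_maps N w" using u rs by (intro index_maps_closed Delta_index_maps) auto
    moreover have "act (mat2 0 1 1 0) ?G = ?G"
      using act_Delta[of 0 1 1 0 0 1 1 0 N] by (simp add: poly_slash_XY_swap)
    moreover have "Lam_inv N w (rel1 N w a b r s) = ?G - act (mat2 1 1 0 1) ?G"
    proof -
      have "poly_slash (XY r s) (mat2 0 1 1 1) = poly_slash (XY s r) (mat2 1 1 0 1)"
        using poly_slash_mult[of "XY r s" "mat2 0 1 1 0" "mat2 1 1 0 1"] by (simp add: poly_slash_XY_swap)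
      then show ?thesis
        using act_Delta[of 1 "-1" 0 1 1 1 0 1 N] u rs
        by (auto simp: rel1_def Lam_inv_fP Lam_inv_lin_fZ poly_slash_in_V XY_in_V)
    qed
    ultimately show ?thesis by blast
  qed
  have rel2: "?sym (rel2 N w a b r s)" if "(a, b) \<in> A_set N" and rs: "r + s = w" for a b r s
  proof -
    have u: "unimod N a b" "unimod N b a"
      using that unimod_transform[of 0 1 1 0 N a b] by (auto simp: A_set_iff)
    have "Lam_inv N w (fS N (a + b) r s) = 0" by (simp add: fS_def fun_eq_iff)
    then have "Lam_inv N w (rel2 N w a b r s) = 0"
      using u rs by (simp add: rel2_def Lam_inv_fP Lam_inv_fZ Lam_inv_lin_fZ poly_slash_XY_swap XY_in_V)
    then show ?thesis by (intro bexI[of _ 0]) auto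
  qed
  from step(1) consider a b r s where "(a, b) \<in> A_set N" "r + s = w" "x = fscale (1 / (fact r * fact s)) (rel1 N w a b r s)"
    | a b r s where "(a, b) \<in> A_set N" "r + s = w" "x = fscale (1 / (fact r * fact s)) (rel2 N w a b r s)"
    unfolding D_relators_eq by blast
  then have "?sym x"
  proof cases
    case 1
    show ?thesis unfolding 1(3) by (rule scale[OF rel1[OF 1(1,2)]])
  next
    case 2
    show ?thesis unfolding 2(3) by (rule scale[OF rel2[OF 2(1,2)]])
  qed
  then show ?case by (intro add[OF scale step(2)])
qed

text \<open>Up to a scalar, an even generator built from \<open>genP\<close> goes to the alternating
  sum of a swap-invariant K over the four diagonal sign matrices. That sum is odd under \<epsilon>,
  and the swap only exchanges the two single sign changes. The generators built from
  \<open>genS\<close> go to 0.\<close>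

lemma Lam_inv_span_P_ev:
  assumes N: "N \<ge> 1" and "x \<in> formal.span (P_ev_gens (w + 2) N)"
  shows "act (mat2 0 1 1 0) (Lam_inv N w x) = Lam_inv N w x \<and> act (mat2 (-1) 0 0 1) (Lam_inv N w x) = - Lam_inv N w x"
  using assms(2)
proof (induction x rule: formal.span_induct_alt)
  case (step c x y)
  let ?ev = "\<lambda>x. act (mat2 0 1 1 0) (Lam_inv N w x) = Lam_inv N w x \<and> act (mat2 (-1) 0 0 1) (Lam_inv N w x) = - Lam_inv N w x"
  have scale: "?ev (fscale c x)" if "?ev x" for c x
    using that by (simp add: act_scale fun_eq_iff)
  have P: "?ev (genP N a b r s + fscale ((-1) ^ r) (genP N (-a) b r s) + fscale ((-1) ^ s) (genP N a (-b) r s)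
        + fscale ((-1) ^ (r + s)) (genP N (-a) (-b) r s))"
    if A: "(a, b) \<in> A_set N" and rs': "r \<ge> 1" "s \<ge> 1" "r + s = w + 2" for a b r s
  proof -
    let ?g = "genP N a b r s + fscale ((-1) ^ r) (genP N (-a) b r s) + fscale ((-1) ^ s) (genP N a (-b) r s)
        + fscale ((-1) ^ (r + s)) (genP N (-a) (-b) r s)"
    obtain r' s' where rs: "r = Suc r'" "s = Suc s'" "r' + s' = w"
      using rs' by (cases r; cases s) auto
    have u: "unimod N a b" "unimod N (- a) b" "unimod N a (- b)" "unimod N (- a) (- b)"
      using A unimod_transform[of "-1" 0 0 1 N a b] unimod_transform[of 1 0 0 "-1" N a b]
        unimod_transform[of "-1" 0 0 "-1" N a b] by (auto simp: A_set_iff)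
    let ?K = "Delta N a b (XY r' s') + Delta N b a (XY s' r')"
    have "?g = fscale (1 / (fact r' * fact s')) (fP N a b r' s' - fscale ((-1) ^ r') (fP N (- a) b r' s')
        - fscale ((-1) ^ s') (fP N a (- b) r' s') + fscale ((-1) ^ (r' + s')) (fP N (- a) (- b) r' s'))"
      by (simp add: fP_def rs formal.scale_right_distrib formal.scale_right_diff_distrib)
    moreover have "Lam_inv N w (fP N a b r' s' - fscale ((-1) ^ r') (fP N (- a) b r' s')
        - fscale ((-1) ^ s') (fP N a (- b) r' s') + fscale ((-1) ^ (r' + s')) (fP N (- a) (- b) r' s')) =
      ?K - act (mat2 (-1) 0 0 1) ?K - act (mat2 1 0 0 (-1)) ?K + act (mat2 (-1) 0 0 (-1)) ?K"
      using rs u act_Delta[of "-1" 0 0 1 "-1" 0 0 1 N] act_Delta[of 1 0 0 "-1" 1 0 0 "-1" N]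
        act_Delta[of "-1" 0 0 "-1" "-1" 0 0 "-1" N]
      by (simp add: Lam_inv_fP fun_eq_iff poly_slash_XY_signs smult_add_right add.commute)
    moreover have "act (mat2 0 1 1 0) (K - act (mat2 (-1) 0 0 1) K - act (mat2 1 0 0 (-1)) K + act (mat2 (-1) 0 0 (-1)) K)
       = K - act (mat2 (-1) 0 0 1) K - act (mat2 1 0 0 (-1)) K + act (mat2 (-1) 0 0 (-1)) K"
      if sym: "act (mat2 0 1 1 0) K = K" for K
    proof -
      have "act (mat2 0 1 1 0) (act (mat2 (-1) 0 0 1) K) = act (mat2 1 0 0 (-1)) (act (mat2 0 1 1 0) K)"
        "act (mat2 0 1 1 0) (act (mat2 1 0 0 (-1)) K) = act (mat2 (-1) 0 0 1) (act (mat2 0 1 1 0) K)"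
        "act (mat2 0 1 1 0) (act (mat2 (-1) 0 0 (-1)) K) = act (mat2 (-1) 0 0 (-1)) (act (mat2 0 1 1 0) K)"
        by (simp_all add: act_act)
      then show ?thesis by (simp add: sym)
    qed
    moreover have "act (mat2 0 1 1 0) ?K = ?K"
      using act_Delta[of 0 1 1 0 0 1 1 0 N] by (simp add: poly_slash_XY_swap)
    moreover have "act (mat2 (-1) 0 0 1) (K - act (mat2 (-1) 0 0 1) K - act (mat2 1 0 0 (-1)) K + act (mat2 (-1) 0 0 (-1)) K)
       = - (K - act (mat2 (-1) 0 0 1) K - act (mat2 1 0 0 (-1)) K + act (mat2 (-1) 0 0 (-1)) K)" for K
      by (simp add: act_act)
    ultimately show ?thesis using scale by presburger
  qed
  have "Lam_inv N w (genS N a k + fscale d (genS N b k)) = 0" for a b d k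
    by (simp add: fun_eq_iff)
  then have S: "?ev (genS N a k + fscale d (genS N b k))" for a b d k
    by simp
  from step(1) consider a b r s where "(a, b) \<in> A_set N" "r \<ge> 1" "s \<ge> 1" "r + s = w + 2"
      "x = genP N a b r s + fscale ((-1) ^ r) (genP N (-a) b r s) + fscale ((-1) ^ s) (genP N a (-b) r s)
        + fscale ((-1) ^ (r + s)) (genP N (-a) (-b) r s)"
    | a where "x = genS N a (w + 2) + fscale ((-1) ^ (w + 2)) (genS N (-a) (w + 2))"
    unfolding P_ev_gens_def by blast
  then have "?ev x"
  proof cases
    case 1
    show ?thesis unfolding 1(5) by (rule P[OF 1(1-4)])
  next
    case 2
    show ?thesis unfolding 2 by (rule S)
  qed
  have add: "?ev (x + y)" if "?ev x" "?ev y" for x y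
    using that by simp
  show ?case by (intro add[OF scale step(2)] \<open>?ev x\<close>)
qed (auto simp: act_def)

section \<open>Period maps\<close>

text \<open>Invariance under -I makes \<open>H\<close> odd under both single sign changes, so the
  alternating sum of \<open>LamP_signs_in_span\<close> is four times \<open>H\<close>.\<close>

lemma LamP_even_in_span:
  assumes N: "N \<ge> 1" and H: "H \<in> index_maps N w" "act (mat2 (-1) 0 0 (-1)) H = H" "act (mat2 (-1) 0 0 1) H = - H"
  shows "LamP N w H \<in> formal.span (P_ev_gens (w + 2) N)"
proof -
  have "act (mat2 1 0 0 (-1)) H = act (mat2 (-1) 0 0 1) (act (mat2 (-1) 0 0 (-1)) H)" by (simp add: act_act)
  also have "\<dots> = - H" by (simp only: H)
  finally have "LamP N w (H - - H - - H + H) \<in> formal.span (P_ev_gens (w + 2) N)"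
    using LamP_signs_in_span[OF N H(1)] by (simp only: H)
  then have "fscale (1 / 4) (LamP N w (H - - H - - H + H)) \<in> formal.span (P_ev_gens (w + 2) N)"
    by (rule formal.span_scale)
  moreover have "fscale (1 / 4) (LamP N w (H - - H - - H + H)) = LamP N w H"
    by (rule poly_mapping_eqI) (simp only: pairing_simps, simp add: lookup_fscale lookup_add)
  ultimately show ?thesis by simp
qed

section \<open>Consequences of the period relations\<close>

locale period_map =
  fixes N w F q qe
  assumes N: "N \<ge> 1" and F: "F \<in> index_maps N w"
    and eps: "act (mat2 (-1) 0 0 1) F = F" and J: "act (mat2 (-1) 0 0 (-1)) F = F"
    and S: "F + act (mat2 0 (-1) 1 0) F = 0"
    and U: "F + act (mat2 1 (-1) 1 0) F + act (mat2 0 (-1) 1 (-1)) F = 0"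
  defines "q \<equiv> act (mat2 1 (-1) 1 0) F" and "qe \<equiv> act (mat2 (-1) 0 0 1) q"
begin

lemma q_index_maps: "q \<in> index_maps N w" and qe_index_maps: "qe \<in> index_maps N w"
  unfolding q_def qe_def using F by (auto intro!: act_index_maps)

lemma q_J: "act (mat2 (-1) 0 0 (-1)) q = q" "act (mat2 (-1) 0 0 (-1)) qe = qe"
proof -
  have "act (mat2 (-1) 0 0 (-1)) q = act (mat2 1 (-1) 1 0) (act (mat2 (-1) 0 0 (-1)) F)"
    by (simp add: q_def act_act)
  then show "act (mat2 (-1) 0 0 (-1)) q = q" by (simp add: J q_def)
  moreover have "act (mat2 (-1) 0 0 (-1)) qe = act (mat2 (-1) 0 0 1) (act (mat2 (-1) 0 0 (-1)) q)"
    by (simp add: qe_def act_act)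
  ultimately show "act (mat2 (-1) 0 0 (-1)) qe = qe" by (simp add: qe_def)
qed

lemma qe_eps: "act (mat2 (-1) 0 0 1) qe = q"
  by (simp add: qe_def act_act)

lemma act_S: "act (mat2 0 (-1) 1 0) F = - F"
  using S by (simp add: add_eq_0_iff)

lemma act_swap: "act (mat2 0 1 1 0) F = - F"
proof -
  have "act (mat2 0 1 1 0) F = act (mat2 0 (-1) 1 0) (act (mat2 (-1) 0 0 1) F)" by (simp add: act_act)
  then show ?thesis by (simp only: eps act_S)
qed

text \<open>The square of U is S times the inverse of T, so the last term of the three-term relation
  is minus the image of \<open>F\<close> under that inverse.\<close>

lemma act_T_inv: "act (mat2 1 (-1) 0 1) F = F + q"
proof -
  have "act (mat2 0 (-1) 1 (-1)) F = act (mat2 1 (-1) 0 1) (act (mat2 0 (-1) 1 0) F)" by (simp add: act_act)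
  then have "act (mat2 0 (-1) 1 (-1)) F = - act (mat2 1 (-1) 0 1) F" by (simp only: act_S act_simps)
  then show ?thesis using U by (simp add: q_def)
qed

lemma act_T: "act (mat2 1 1 0 1) F = F + qe"
proof -
  have "act (mat2 1 1 0 1) (act (mat2 (-1) 0 0 1) F) = act (mat2 (-1) 0 0 1) (act (mat2 1 (-1) 0 1) F)"
    by (simp add: act_act)
  then show ?thesis by (simp only: eps act_T_inv act_simps qe_def)
qed

text \<open>U times the swap is \<epsilon> times the inverse of T, and U\<epsilon> times the swap is
  -T. The summand \<open>F\<close> cancels in \<open>q - qe\<close>, whence its swap
  invariance.\<close>

lemma swap_q: "act (mat2 0 1 1 0) q = F + q" "act (mat2 0 1 1 0) qe = F + qe"
proof -
  have "act (mat2 0 1 1 0) q = act (mat2 1 (-1) 0 1) (act (mat2 (-1) 0 0 1) F)"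
    by (simp add: q_def act_act)
  then show "act (mat2 0 1 1 0) q = F + q" by (simp only: eps act_T_inv)
  have "act (mat2 0 1 1 0) qe = act (mat2 1 1 0 1) (act (mat2 (-1) 0 0 (-1)) F)"
    by (simp add: q_def qe_def act_act)
  then show "act (mat2 0 1 1 0) qe = F + qe" by (simp only: J act_T)
qed

lemma Lam_relation: "Lam N w q + Lam N w q + Lam N w qe + LamS N w q \<in> formal.span (D_relators (w + 2) N)"
proof -
  let ?G = "- F - q - q"
  have "act (mat2 0 1 1 0) ?G = ?G"
    by (simp only: act_simps swap_q act_swap) (simp add: algebra_simps)
  moreover have "?G \<in> index_maps N w" using F q_index_maps by (intro index_maps_closed)
  ultimately have "fscale 2 (Lam N w (act (mat2 1 1 0 1) ?G - ?G)) - LamS N w ?G \<in> formal.span (D_relators (w + 2) N)"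
    using Lam_symmetric(1)[OF N] by blast
  moreover have "act (mat2 1 1 0 1) ?G - ?G = q + q + qe"
  proof -
    \<comment> \<open>Applying T to the formula for its inverse determines T on
      \<open>q\<close>.\<close>
    have "act (mat2 1 1 0 1) (act (mat2 1 (-1) 0 1) F) = F" by (simp add: act_act)
    then have "act (mat2 1 1 0 1) q = - qe" by (simp add: act_T_inv act_T add_eq_0_iff)
    then have "act (mat2 1 1 0 1) ?G = - (F + qe) - - qe - - qe" by (simp only: act_simps act_T)
    then show ?thesis by simp
  qed
  \<comment> \<open>\<open>F\<close> is odd under the swap, whereas \<open>LamS\<close> is
    invariant.\<close>
  moreover have "LamS N w F = 0"
  proof -
    have "LamS N w F = - LamS N w F" using LamS_swap[OF N F] by (simp add: act_swap)
    then have "poly_mapping.lookup (LamS N w F) g = - poly_mapping.lookup (LamS N w F) g" for g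
      by (metis lookup_uminus)
    then show ?thesis by (intro poly_mapping_eqI) (metis equal_neg_zero lookup_zero)
  qed
  then have "LamS N w ?G = - LamS N w q - LamS N w q" by (simp only: pairing_simps) simp
  ultimately have "fscale 2 (Lam N w (q + q + qe)) - (- LamS N w q - LamS N w q) \<in> formal.span (D_relators (w + 2) N)"
    by (simp only:)
  then have "fscale (1 / 2) (fscale 2 (Lam N w (q + q + qe)) - (- LamS N w q - LamS N w q)) \<in> formal.span (D_relators (w + 2) N)"
    by (rule formal.span_scale)
  moreover have "fscale (1 / 2) (fscale 2 x - (- y - y)) = x + y" for x y :: "D_gen \<Rightarrow>\<^sub>0 rat"
    by (rule poly_mapping_eqI) (simp add: lookup_fscale lookup_add lookup_minus)
  ultimately show ?thesis by (simp only: pairing_simps)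
qed

end

section \<open>Construction of a period map from an even pairing\<close>

lemma period_map_of_even:
  assumes g: "g \<in> index_maps N w" "act (mat2 (-1) 0 0 (-1)) g = g" "act (mat2 0 1 1 0) g = g"
    and h: "act (mat2 0 1 1 0) h = h" "act (mat2 (-1) 0 0 1) h = - h"
    and X: "act (mat2 (-1) 0 0 1) X = X" "X = h + act (mat2 1 1 0 1) g - g"
  obtains P where "P \<in> index_maps N w" "act (mat2 (-1) 0 0 (-1)) P = P" "act (mat2 (-1) 0 0 1) P = P"
    "P + act (mat2 0 (-1) 1 0) P = 0"
    "P + act (mat2 1 (-1) 1 0) P + act (mat2 0 (-1) 1 (-1)) P = 0"
    "X + X = act (mat2 1 (-1) 1 0) P + act (mat2 (-1) 0 0 1) (act (mat2 1 (-1) 1 0) P)"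
proof
  define \<alpha> where "\<alpha> = act (mat2 1 1 0 1) g"
  define \<beta> where "\<beta> = act (mat2 (-1) 0 0 1) \<alpha>"
  define \<gamma> where "\<gamma> = act (mat2 (-1) 0 0 1) g"
  define P where "P = act (mat2 1 (-1) 1 0) g - act (mat2 0 (-1) 1 (-1)) g"
  have h_eq: "h = X - \<alpha> + g" using X(2) by (simp add: \<alpha>_def)
  \<comment> \<open>Splitting the equation for \<open>X\<close> into \<epsilon>-even and
    \<epsilon>-odd parts expresses both \<open>X\<close> and \<open>h\<close> through
    \<open>g\<close>.\<close>
  have "X - \<beta> + \<gamma> = act (mat2 (-1) 0 0 1) (X - \<alpha> + g)" by (simp add: X(1) \<beta>_def \<gamma>_def)
  also have "\<dots> = - (X - \<alpha> + g)" using h(2) by (simp only: h_eq)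
  finally have XX: "X + X = \<alpha> - g + \<beta> - \<gamma>" by (simp add: algebra_simps)
  then have hh: "h + h = \<beta> - \<alpha> + g - \<gamma>" by (simp add: h_eq algebra_simps)
  have "act (mat2 0 1 1 0) \<gamma> = act (mat2 (-1) 0 0 1) (act (mat2 (-1) 0 0 (-1)) (act (mat2 0 1 1 0) g))"
    by (simp add: \<gamma>_def act_act)
  then have "act (mat2 0 1 1 0) \<gamma> = \<gamma>" by (simp only: g \<gamma>_def)
  moreover have "act (mat2 0 1 1 0) (h + h) = h + h" by (simp only: act_simps h(1))
  \<comment> \<open>As \<open>g\<close> and \<gamma> are swap-invariant, invariance of
    \<open>h + h\<close> leaves this condition. It gives \<open>P\<close> a second form in \<alpha>,
    and \<epsilon> exchanges the two forms.\<close>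
  ultimately have swap: "act (mat2 0 1 1 0) \<beta> - act (mat2 0 1 1 0) \<alpha> = \<beta> - \<alpha>"
    unfolding hh by (simp add: g(3))
  have u: "act (mat2 1 (-1) 1 0) g = act (mat2 0 1 1 0) \<beta>"
    by (simp add: \<beta>_def \<alpha>_def act_act)
  have "act (mat2 0 (-1) 1 (-1)) g = act (mat2 0 1 1 0) (act (mat2 1 (-1) 1 0) (act (mat2 0 1 1 0) (act (mat2 (-1) 0 0 (-1)) g)))"
    by (simp add: act_act)
  also have "\<dots> = act (mat2 0 1 1 0) (act (mat2 0 1 1 0) \<beta>)" by (simp only: g u)
  finally have u2: "act (mat2 0 (-1) 1 (-1)) g = \<beta>" by (simp add: act_act)
  have P1: "P = act (mat2 0 1 1 0) \<beta> - \<beta>" by (simp only: P_def u u2)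
  also have "\<dots> = (act (mat2 0 1 1 0) \<beta> - act (mat2 0 1 1 0) \<alpha>) + (act (mat2 0 1 1 0) \<alpha> - \<beta>)" by simp
  also have "\<dots> = act (mat2 0 1 1 0) \<alpha> - \<alpha>" unfolding swap by simp
  finally have P2: "P = act (mat2 0 1 1 0) \<alpha> - \<alpha>" .
  show "P \<in> index_maps N w" unfolding P_def using g(1) by (intro index_maps_closed act_index_maps) auto
  have "act (mat2 (-1) 0 0 (-1)) P = act (mat2 1 (-1) 1 0) (act (mat2 (-1) 0 0 (-1)) g)
      - act (mat2 0 (-1) 1 (-1)) (act (mat2 (-1) 0 0 (-1)) g)"
    by (simp add: P_def act_act)
  then show "act (mat2 (-1) 0 0 (-1)) P = P" by (simp only: g P_def)
  have "act (mat2 (-1) 0 0 1) (act (mat2 0 1 1 0) \<beta>) = act (mat2 0 1 1 0) (act (mat2 1 1 0 1) (act (mat2 (-1) 0 0 (-1)) g))"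
    by (simp add: \<beta>_def \<alpha>_def act_act)
  then have "act (mat2 (-1) 0 0 1) (act (mat2 0 1 1 0) \<beta>) = act (mat2 0 1 1 0) \<alpha>" by (simp only: g \<alpha>_def)
  moreover have eb: "act (mat2 (-1) 0 0 1) \<beta> = \<alpha>" by (simp add: \<beta>_def act_act)
  ultimately have "act (mat2 (-1) 0 0 1) P = act (mat2 0 1 1 0) \<alpha> - \<alpha>" by (simp only: P1 act_simps)
  then show eP: "act (mat2 (-1) 0 0 1) P = P" by (rule trans[OF _ P2[symmetric]])
  have "act (mat2 0 (-1) 1 0) P = act (mat2 0 1 1 0) (act (mat2 (-1) 0 0 1) P)" by (simp add: act_act)
  also have "\<dots> = act (mat2 0 1 1 0) P" by (simp only: eP)
  also have "\<dots> = - P" by (simp add: P1 act_act)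
  finally show "P + act (mat2 0 (-1) 1 0) P = 0" by simp
  \<comment> \<open>The cube of U is -I, which fixes \<open>g\<close>; so U permutes
    \<open>g\<close> and its two images cyclically and the three terms telescope.\<close>
  have "act (mat2 1 (-1) 1 0) P = act (mat2 0 (-1) 1 (-1)) g - act (mat2 (-1) 0 0 (-1)) g"
    by (simp add: P_def act_act)
  then have UP: "act (mat2 1 (-1) 1 0) P = \<beta> - g" by (simp only: g u2)
  have "act (mat2 0 (-1) 1 (-1)) P = act (mat2 (-1) 0 0 (-1)) g - act (mat2 1 (-1) 1 0) (act (mat2 (-1) 0 0 (-1)) g)"
    by (simp add: P_def act_act)
  then have "act (mat2 0 (-1) 1 (-1)) P = g - act (mat2 0 1 1 0) \<beta>" by (simp only: g u)
  then have "P + act (mat2 1 (-1) 1 0) P + act (mat2 0 (-1) 1 (-1)) P = P + (\<beta> - g) + (g - act (mat2 0 1 1 0) \<beta>)"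
    by (simp only: UP)
  then show "P + act (mat2 1 (-1) 1 0) P + act (mat2 0 (-1) 1 (-1)) P = 0" unfolding P1 by simp
  show "X + X = act (mat2 1 (-1) 1 0) P + act (mat2 (-1) 0 0 1) (act (mat2 1 (-1) 1 0) P)"
    by (simp add: UP XX eb \<gamma>_def)
qed

lemma scale_half_eq_iff: "(F = (\<lambda>a b. smult [:1 / 2:] (G a b))) \<longleftrightarrow> F + F = G" for F G :: "int \<Rightarrow> int \<Rightarrow> rat poly poly"
proof -
  have "p = smult [:1 / 2:] q \<longleftrightarrow> p + p = q" for p q :: "rat poly poly"
  proof
    assume "p + p = q"
    moreover have "smult [:1 / 2:] (p + p) = p" by (rule ev_eqI) simp
    ultimately show "p = smult [:1 / 2:] q" by simp
  next
    assume "p = smult [:1 / 2:] q"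
    then show "p + p = q" by (intro ev_eqI) simp
  qed
  then show ?thesis by (simp add: fun_eq_iff)
qed

text \<open>Applying \<open>Lam_inv\<close> to the membership hypothesis recovers \<open>F\<close>
  as an even-subspace part plus a relator part.\<close>

lemma period_map_exists:
  assumes N: "N \<ge> 1" and F: "F \<in> index_maps N w" "act (mat2 (-1) 0 0 (-1)) F = F" "act (mat2 (-1) 0 0 1) F = F"
    and y: "y \<in> formal.span (P_ev_gens (w + 2) N)" "Lam N w F - y \<in> formal.span (D_relators (w + 2) N)"
  obtains P where "P \<in> index_maps N w" "act (mat2 (-1) 0 0 (-1)) P = P" "act (mat2 (-1) 0 0 1) P = P"
    "P + act (mat2 0 (-1) 1 0) P = 0"
    "P + act (mat2 1 (-1) 1 0) P + act (mat2 0 (-1) 1 (-1)) P = 0"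
    "F + F = act (mat2 1 (-1) 1 0) P + act (mat2 (-1) 0 0 1) (act (mat2 1 (-1) 1 0) P)"
proof -
  define H where "H = Lam_inv N w y"
  have H: "act (mat2 0 1 1 0) H = H" "act (mat2 (-1) 0 0 1) H = - H"
    using Lam_inv_span_P_ev[OF N y(1)] by (simp_all add: H_def)
  obtain G where G: "G \<in> index_maps N w" "act (mat2 0 1 1 0) G = G" "Lam_inv N w (Lam N w F - y) = G - act (mat2 1 1 0 1) G"
    using Lam_inv_span_relators[OF N y(2)] by blast
  then have F_eq: "F = H + G - act (mat2 1 1 0 1) G"
    by (simp add: Lam_inv_Lam[OF N F(1)] H_def algebra_simps)
  let ?J = "mat2 (-1) 0 0 (-1)"
  \<comment> \<open>The function \<open>G\<close> obtained from the relators need not be invariant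
    under -I, so the equation is added to its image under -I. The sign of \<open>g\<close> turns G
    minus its shift into the shift minus the identity.\<close>
  define g where "g = - G - act ?J G"
  define h where "h = H + act ?J H"
  have comm: "act ?J (act (mat2 p q r s) K) = act (mat2 p q r s) (act ?J K)" for p q r s K
    by (simp add: act_act)
  have "act ?J F = act ?J H + act ?J G - act (mat2 1 1 0 1) (act ?J G)"
    by (subst F_eq) (simp add: comm)
  then have F_eq': "F = act ?J H + act ?J G - act (mat2 1 1 0 1) (act ?J G)" by (simp only: F)
  have X: "F + F = h + act (mat2 1 1 0 1) g - g"
  proof -
    have "F + F = (H + G - act (mat2 1 1 0 1) G) + (act ?J H + act ?J G - act (mat2 1 1 0 1) (act ?J G))"
      by (rule arg_cong2[of _ _ _ _ "(+)"]) (fact F_eq F_eq')+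
    then show ?thesis by (simp add: g_def h_def algebra_simps)
  qed
  have "g \<in> index_maps N w" unfolding g_def using G(1) by (intro index_maps_closed act_index_maps) auto
  moreover have "act ?J g = g" by (simp add: g_def act_act)
  moreover have "act (mat2 0 1 1 0) g = g" by (simp add: g_def comm[symmetric] G(2))
  moreover have "act (mat2 0 1 1 0) h = h" "act (mat2 (-1) 0 0 1) h = - h"
    by (simp_all add: h_def comm[symmetric] H)
  moreover have "act (mat2 (-1) 0 0 1) (F + F) = F + F" by (simp only: act_simps F(3))
  ultimately obtain P where P: "P \<in> index_maps N w" "act ?J P = P" "act (mat2 (-1) 0 0 1) P = P"
    "P + act (mat2 0 (-1) 1 0) P = 0"
    "P + act (mat2 1 (-1) 1 0) P + act (mat2 0 (-1) 1 (-1)) P = 0"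
    "(F + F) + (F + F) = act (mat2 1 (-1) 1 0) P + act (mat2 (-1) 0 0 1) (act (mat2 1 (-1) 1 0) P)"
    using X by (rule period_map_of_even)
  \<comment> \<open>The construction was applied to \<open>F + F\<close>, which doubles the period
    map.\<close>
  define P' where "P' = (\<lambda>a b. smult [:1 / 2:] (P a b))"
  have lin: "act m P' = (\<lambda>a b. smult [:1 / 2:] (act m P a b))" for m by (simp add: P'_def act_scale)
  have add: "(\<lambda>a b. smult [:1 / 2:] (A a b)) + (\<lambda>a b. smult [:1 / 2:] (B a b)) = (\<lambda>a b. smult [:1 / 2:] ((A + B) a b))"
    for A B :: "int \<Rightarrow> int \<Rightarrow> rat poly poly"
    by (simp add: fun_eq_iff smult_add_right)
  show thesis
  proof (rule that[of P'])
    show "P' \<in> index_maps N w" unfolding P'_def by (rule index_maps_scale[OF P(1)])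
    show "act ?J P' = P'" "act (mat2 (-1) 0 0 1) P' = P'" unfolding lin P(2,3) by (simp_all only: P'_def)
    have "P' + act (mat2 0 (-1) 1 0) P' = (\<lambda>a b. smult [:1 / 2:] ((P + act (mat2 0 (-1) 1 0) P) a b))"
      unfolding lin by (simp only: P'_def add)
    then show "P' + act (mat2 0 (-1) 1 0) P' = 0" by (simp only: P(4)) (simp add: fun_eq_iff)
    have "P' + act (mat2 1 (-1) 1 0) P' + act (mat2 0 (-1) 1 (-1)) P' =
        (\<lambda>a b. smult [:1 / 2:] ((P + act (mat2 1 (-1) 1 0) P + act (mat2 0 (-1) 1 (-1)) P) a b))"
      unfolding lin by (simp only: P'_def add)
    then show "P' + act (mat2 1 (-1) 1 0) P' + act (mat2 0 (-1) 1 (-1)) P' = 0"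
      by (simp only: P(5)) (simp add: fun_eq_iff)
    have "F + F = (\<lambda>a b. smult [:1 / 2:] ((act (mat2 1 (-1) 1 0) P + act (mat2 (-1) 0 0 1) (act (mat2 1 (-1) 1 0) P)) a b))"
      unfolding scale_half_eq_iff by (rule P(6))
    then show "F + F = act (mat2 1 (-1) 1 0) P' + act (mat2 (-1) 0 0 1) (act (mat2 1 (-1) 1 0) P')"
      unfolding lin act_scale by (simp only: add)
  qed
qed

section \<open>Return to the quotient space and conclusion\<close>

lemma lam_in_P_ev_iff:
  assumes N: "N \<ge> 1"
  shows "lam N w R \<in> P_ev (w + 2) N \<longleftrightarrow>
    (\<exists>y\<in>formal.span (P_ev_gens (w + 2) N). Lam N w (conv N R) - y \<in> formal.span (D_relators (w + 2) N))"
proof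
  assume "lam N w R \<in> P_ev (w + 2) N"
  then obtain y where y: "y \<in> formal.span (P_ev_gens (w + 2) N)"
      "D_class (w + 2) N (Lam N w (conv N R)) = D_class (w + 2) N y"
    by (auto simp: P_ev_def lam_eq_Lam[OF N])
  \<comment> \<open>Classes contain only elements of \<open>formal_space\<close>, so equality of
    classes yields membership through \<open>Lam_formal\<close>.\<close>
  then have "Lam N w (conv N R) \<in> D_class (w + 2) N y"
    using D_class_self[OF Lam_formal[OF N]] by blast
  then show "\<exists>y\<in>formal.span (P_ev_gens (w + 2) N). Lam N w (conv N R) - y \<in> formal.span (D_relators (w + 2) N)"
    using y(1) by (auto simp: D_class_def)
next
  assume "\<exists>y\<in>formal.span (P_ev_gens (w + 2) N). Lam N w (conv N R) - y \<in> formal.span (D_relators (w + 2) N)"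
  then show "lam N w R \<in> P_ev (w + 2) N"
    unfolding P_ev_def lam_eq_Lam[OF N] using D_class_eqI by blast
qed

theorem theorem2p6:
  fixes N w k :: nat and \<Gamma> :: "(int^2^2) set"
  assumes "N \<ge> 1" and "k = w + 2" and "(k, N) \<noteq> (2, 1)" and "\<Gamma> = Gamma1 N"
  shows "(\<forall>P \<in> Wbar_plus \<Gamma> w. \<forall>Q Qp Qm.
            Q = slash \<Gamma> P mat_U \<and>
            Qp = mscale \<Gamma> (1/2) (madd \<Gamma> Q (slash_eps \<Gamma> Q)) \<and>
            Qm = mscale \<Gamma> (1/2) (madd \<Gamma> Q (mscale \<Gamma> (-1) (slash_eps \<Gamma> Q))) \<longrightarrow>
            Qp \<in> Vbar_plus \<Gamma> w \<and> Qm \<in> Vbar_minus \<Gamma> w \<and>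
            Qm \<in> Vbar_minus_sym \<Gamma> w \<and>
            D_scale k N 3 (lam N w Qp) =
              D_add k N (D_scale k N (-1) (lam N w Qm)) (D_scale k N (-1) (lamS N w Q)) \<and>
            D_scale k N 3 (lam N w Qp) \<in> P_ev k N) \<and>
         (\<forall>R \<in> Vbar_plus \<Gamma> w.
            lam N w R \<in> P_ev k N \<longleftrightarrow>
            (\<exists>P \<in> Wbar_plus \<Gamma> w.
               R = mscale \<Gamma> (1/2) (madd \<Gamma> (slash \<Gamma> P mat_U) (slash_eps \<Gamma> (slash \<Gamma> P mat_U)))))"
proof -
  note N = assms(1)
  have U: "det mat_U = 1" by (simp add: mat_U_def)
  define Q where "Q P = slash \<Gamma> P mat_U" for P
  define Qp where "Qp P = mscale \<Gamma> (1/2) (madd \<Gamma> (Q P) (slash_eps \<Gamma> (Q P)))" for P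
  define Qm where "Qm P = mscale \<Gamma> (1/2) (madd \<Gamma> (Q P) (mscale \<Gamma> (-1) (slash_eps \<Gamma> (Q P))))" for P
  let ?q = "\<lambda>P. act (mat2 1 (-1) 1 0) (conv N P)"
  let ?qe = "\<lambda>P. act (mat2 (-1) 0 0 1) (?q P)"
  have conv_Q: "conv N (Q P) = ?q P" for P
    unfolding Q_def assms(4) conv_slash[OF N U] by (simp add: mat_U_def)
  have conv_Qp: "conv N (Qp P) = (\<lambda>a b. smult [:1 / 2:] ((?q P + ?qe P) a b))" for P
    unfolding Qp_def conv_mscale[OF N] conv_madd[OF N] conv_slash_eps[OF N] conv_Q assms(4)
    by (simp add: mat_eps_def flip: assms(4))
  have conv_Qm: "conv N (Qm P) = (\<lambda>a b. smult [:1 / 2:] ((?q P - ?qe P) a b))" for P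
  proof -
    have "(\<lambda>a b. smult [:- 1:] (F a b)) = - F" for F :: "int \<Rightarrow> int \<Rightarrow> rat poly poly"
      by (intro ext ev_eqI) simp
    then show ?thesis
      unfolding Qm_def conv_mscale[OF N] conv_madd[OF N] conv_slash_eps[OF N] conv_Q assms(4)
      by (simp only: conv_mscale[OF N] conv_madd[OF N] conv_slash_eps[OF N] conv_Q mat_eps_def
          add_uminus_conv_diff)
  qed
  \<comment> \<open>The last conjunct, without the factor 3, serves the if direction of the converse
    claim.\<close>
  have "Qp P \<in> Vbar_plus \<Gamma> w \<and> Qm P \<in> Vbar_minus \<Gamma> w \<and> Qm P \<in> Vbar_minus_sym \<Gamma> w \<and>
      D_scale k N 3 (lam N w (Qp P)) =
        D_add k N (D_scale k N (-1) (lam N w (Qm P))) (D_scale k N (-1) (lamS N w (Q P))) \<and>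
      D_scale k N 3 (lam N w (Qp P)) \<in> P_ev k N \<and> lam N w (Qp P) \<in> P_ev k N"
    if P: "P \<in> Wbar_plus \<Gamma> w" for P
  proof -
    interpret period_map N w "conv N P" "?q P" "?qe P"
      using P N unfolding assms(4) Wbar_plus_iff[OF N] Vbar_plus_iff[OF N] Vbar_iff[OF N]
      by unfold_locales auto
    let ?p = "conv N (Qp P)" and ?m = "conv N (Qm P)"
    have pE: "?p \<in> index_maps N w" and mE: "?m \<in> index_maps N w"
      unfolding conv_Qp conv_Qm using index_maps_scale[OF index_maps_closed(2)[OF q_index_maps qe_index_maps]] index_maps_scale[OF index_maps_closed(3)[OF q_index_maps qe_index_maps]]
      by blast+
    have pJ: "act (mat2 (-1) 0 0 (-1)) ?p = ?p" and mJ: "act (mat2 (-1) 0 0 (-1)) ?m = ?m"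
      unfolding conv_Qp conv_Qm act_scale by (simp_all only: act_simps q_J)
    have p_eps: "act (mat2 (-1) 0 0 1) ?p = ?p"
      unfolding conv_Qp act_scale by (simp only: act_simps qe_eps add.commute)
    have m_eps: "act (mat2 (-1) 0 0 1) ?m = - ?m"
      unfolding conv_Qm act_scale by (simp only: act_simps qe_eps) (simp add: fun_eq_iff smult_diff_right)
    have m_swap: "act (mat2 0 1 1 0) ?m = ?m"
      unfolding conv_Qm act_scale by (simp only: act_simps swap_q) simp
    have ext: "Qp P \<in> extensional (rcosets\<^bsub>SL2Z\<^esub> (Gamma1 N))" "Qm P \<in> extensional (rcosets\<^bsub>SL2Z\<^esub> (Gamma1 N))"
      by (simp_all add: Qp_def Qm_def assms(4))
    have mem: "Qp P \<in> Vbar_plus \<Gamma> w" "Qm P \<in> Vbar_minus \<Gamma> w" "Qm P \<in> Vbar_minus_sym \<Gamma> w"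
      using pE mE pJ mJ p_eps m_eps m_swap ext
      by (simp_all add: assms(4) Vbar_plus_iff[OF N] Vbar_iff[OF N] Vbar_minus_iff[OF N] Vbar_minus_sym_iff[OF N])
    let ?rhs = "fscale (-1) (Lam N w ?m) + fscale (-1) (LamS N w (?q P))"
    have fs: "Lam N w F \<in> formal_space k N" "LamS N w F \<in> formal_space k N" for F
      using Lam_formal[OF N] LamS_formal[OF N] by (simp_all add: assms(2))
    have fsc: "fscale c x \<in> formal_space k N" if "x \<in> formal_space k N" for c x
      using that formal.span_scale[of x "formal_space k N" c] by (simp only: span_formal_space)
    have lhs: "D_scale k N c (lam N w (Qp P)) = D_class k N (fscale c (Lam N w ?p))" for c
      by (simp only: lam_eq_Lam[OF N] assms(2)[symmetric] D_scale_class fs)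
    have rhs: "D_add k N (D_scale k N (-1) (lam N w (Qm P))) (D_scale k N (-1) (lamS N w (Q P))) = D_class k N ?rhs"
      by (simp only: lam_eq_Lam[OF N] lamS_eq_LamS[OF N] assms(2)[symmetric] D_scale_class fs D_add_class fsc conv_Q)
    \<comment> \<open>Three times the half sum plus the half difference of \<open>?q P\<close> and
      \<open>?qe P\<close> is twice the former plus the latter, as in
      \<open>Lam_relation\<close>.\<close>
    have "fscale 3 (Lam N w ?p) - ?rhs = Lam N w (?q P) + Lam N w (?q P) + Lam N w (?qe P) + LamS N w (?q P)"
      unfolding conv_Qp conv_Qm pairing_simps
      by (rule poly_mapping_eqI) (simp add: lookup_fscale lookup_add lookup_minus field_simps)
    then have eq: "D_class k N (fscale 3 (Lam N w ?p)) = D_class k N ?rhs"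
      using Lam_relation by (intro D_class_eqI) (simp only: assms(2))
    \<comment> \<open>The representative in the even span arises by solving the second part of
      \<open>Lam_symmetric\<close>, taken at \<open>?m\<close>, for
      \<open>Lam N w ?m\<close>.\<close>
    let ?y = "fscale (-1/2) (LamP N w ?m) + fscale (1/2) (LamS N w ?m) + fscale (-1) (LamS N w (?q P))"
    have y: "?y \<in> formal.span (P_ev_gens k N)"
      using LamP_even_in_span[OF N mE mJ m_eps] LamS_in_span[OF N mE mJ] LamS_in_span[OF N q_index_maps q_J(1)]
      unfolding assms(2) by (intro formal.span_add formal.span_scale)
    have "?rhs - ?y = fscale (1/2) (LamP N w ?m - (fscale 2 (Lam N w ?m) + LamS N w ?m))"
      by (rule poly_mapping_eqI) (simp add: lookup_fscale lookup_add lookup_minus field_simps)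
    then have "D_class k N ?rhs = D_class k N ?y"
      using Lam_symmetric(2)[OF N mE m_swap] unfolding assms(2)
      by (intro D_class_eqI) (simp only: formal.span_scale)
    with y eq have 3: "D_class k N (fscale 3 (Lam N w ?p)) \<in> P_ev k N" by (simp add: P_ev_def)
    have "D_class k N (fscale 3 (Lam N w ?p)) = D_class k N ?y" using eq \<open>D_class k N ?rhs = D_class k N ?y\<close> by simp
    then have "fscale 3 (Lam N w ?p) - ?y \<in> formal.span (D_relators k N)"
      using D_class_self[OF fsc[OF fs(1)], of 3 ?p] by (simp add: D_class_def)
    \<comment> \<open>Division by 3 passes to the class of \<open>Qp P\<close> itself.\<close>
    then have "fscale (1/3) (fscale 3 (Lam N w ?p) - ?y) \<in> formal.span (D_relators k N)" by (rule formal.span_scale)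
    then have "Lam N w ?p - fscale (1/3) ?y \<in> formal.span (D_relators k N)"
      by (simp only: formal.scale_right_diff_distrib formal.scale_scale) simp
    then have "lam N w (Qp P) \<in> P_ev k N"
      unfolding assms(2) lam_in_P_ev_iff[OF N]
      using formal.span_scale[OF y, of "1/3"] unfolding assms(2) by blast
    with mem eq 3 show ?thesis by (simp only: lhs rhs)
  qed
  note forward = this
  have backward: "\<exists>P\<in>Wbar_plus \<Gamma> w. R = Qp P" if R: "R \<in> Vbar_plus \<Gamma> w" and lam: "lam N w R \<in> P_ev k N" for R
  proof -
    have F: "conv N R \<in> index_maps N w" "act (mat2 (-1) 0 0 (-1)) (conv N R) = conv N R" "act (mat2 (-1) 0 0 1) (conv N R) = conv N R"
      and R_ext: "R \<in> extensional (rcosets\<^bsub>SL2Z\<^esub> (Gamma1 N))"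
      using R by (auto simp: assms(4) Vbar_plus_iff[OF N] Vbar_iff[OF N])
    obtain y where y: "y \<in> formal.span (P_ev_gens (w + 2) N)" "Lam N w (conv N R) - y \<in> formal.span (D_relators (w + 2) N)"
      using lam unfolding assms(2) lam_in_P_ev_iff[OF N] by blast
    obtain F' where F': "F' \<in> index_maps N w" "act (mat2 (-1) 0 0 (-1)) F' = F'" "act (mat2 (-1) 0 0 1) F' = F'"
      "F' + act (mat2 0 (-1) 1 0) F' = 0"
      "F' + act (mat2 1 (-1) 1 0) F' + act (mat2 0 (-1) 1 (-1)) F' = 0"
      "conv N R + conv N R = act (mat2 1 (-1) 1 0) F' + act (mat2 (-1) 0 0 1) (act (mat2 1 (-1) 1 0) F')"
      by (rule period_map_exists[OF N F y])
    obtain P where P: "P \<in> rcosets\<^bsub>SL2Z\<^esub> (Gamma1 N) \<rightarrow>\<^sub>E V w" "conv N P = F'"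
      using conv_surj[OF N F'(1)] .
    have "P \<in> Wbar_plus \<Gamma> w"
      using P F' by (simp add: assms(4) Wbar_plus_iff[OF N] Vbar_plus_iff[OF N] Vbar_iff[OF N] PiE_iff_conv[OF N])
    moreover have "conv N R = conv N (Qp P)"
      unfolding conv_Qp P(2) scale_half_eq_iff by (rule F'(6))
    then have "R = Qp P"
      by (rule conv_eqI[OF N R_ext, rotated]) (simp add: Qp_def assms(4))
    ultimately show ?thesis by blast
  qed
  show ?thesis
    using forward backward unfolding Qp_def Qm_def Q_def by blast
qed

end
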